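(* Let $\mathfrak I\in\mathbb S$, let $\Omega_{\mathfrak I}^+\subseteq\mathbb C_{\mathfrak I}^+$, let $E$ be a spectral measure on $\mathscr B(\Omega_{\mathfrak I}^+)$ with associated imaginary operator $J$, and let $f:\Omega_{\mathfrak I}^+\to\mathbb C_{\mathfrak I}\cup\{\infty\}$ be a Borel measurable, $E$-a.e. finite, intrinsic function. Then $$\sigma_S(\mathbb I(f))\cap\mathbb C_{\mathfrak I}^+=\{s\in\mathbb C_{\mathfrak I}^+:\ E(\{\lambda\in\Omega_{\mathfrak I}^+:\ |f(\lambda)^2-2\mathrm{Re}(s)f(\lambda)+|s|^2|<\varepsilon\})\ne0\ \text{ for all }\varepsilon>0\}.$$
   Context: Let $n\ge1$. $\mathbb R_n$ is the real Clifford algebra (of real dimension $2^n$) generated by $e_1,\dots,e_n$ with $e_i^2=-1$ and $e_ie_j=-e_je_i$ for $i\ne j$; it has basis $e_\alpha=e_{i_1}\cdots e_{i_r}$ for $\alpha=\{i_1<\cdots<i_r\}\subseteq\{1,\dots,n\}$, $e_\emptyset=1$. For $a=\sum_\alpha a_\alpha e_\alpha$ ($a_\alpha\in\mathbb R$): $\mathrm{Re}(a)=a_\emptyset$, $|a|=(\sum_\alpha a_\alpha^2)^{1/2}$, and $a\mapsto\bar a$ is the real-linear map with $\overline{ab}=\bar b\,\bar a$, $\bar 1=1$, $\bar e_j=-e_j$. $\mathcal H$ is a real Hilbert space and $\mathcal H_n=\mathcal H\otimes\mathbb R_n$ is the two-sided Clifford module of elements $x=\sum_\alpha x_\alpha e_\alpha$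 ($x_\alpha\in\mathcal H$), with $\langle x,y\rangle=\sum_{\alpha,\beta}\bar e_\beta e_\alpha\langle x_\alpha,y_\beta\rangle_{\mathcal H}\in\mathbb R_n$ (so $\langle xa,y\rangle=\langle x,y\rangle a$) and norm $\|x\|=(\sum_\alpha\|x_\alpha\|^2)^{1/2}=(\mathrm{Re}\langle x,x\rangle)^{1/2}$. $\mathcal L(\mathcal H_n)$ is the set of right $\mathbb R_n$-linear operators $T:\mathcal D(T)\to\mathcal H_n$, $\mathcal D(T)$ a right submodule; $\mathcal B(\mathcal H_n)$ is the set of everywhere defined bounded ones. An imaginary operator is a unitary $J\in\mathcal B(\mathcal H_n)$ with $J^*=-J$. An orthogonal projection is a self-adjoint $P\in\mathcal B(\mathcal H_n)$ with $P^2=P$. $\mathbb R^{n+1}$ is identified with the paravectors $s=s_0+\sum_{j=1}^n s_je_j$. $\mathbb S=\{\sum_{j=1}^n\mathfrak I_je_j:\sum\mathfrak I_j^2=1\}$ (so $\mathfrak I^2=-1$). For $\mathfrak I\in\mathbb S$, $\mathbb C_{\mathfrak I}=\{\lambda_0+\lambda_1\mathfrak I:\lambda_0,\lambda_1\in\mathbb R\}$, $\mathbb C_{\mathfrak I}^+=\{\lambda_0+\lambda_1\mathfrak I:\lambda_1\ge0\}$, $\mathrm{Re}(\lambda)=\lambda_0$, $\mathrm{Im}(\lambda)=\lambda_1\in\mathbb R$. For densely defined $T\in\mathcal L(\mathcal H_n)$, with $\mathcal Q_s(T)=T^2-2\mathrm{Re}(s)T+|s|^2I$ on $\mathcal D(T^2)$,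 $\rho_S(T)$ is the set of $s\in\mathbb R^{n+1}$ such that $\mathcal Q_s(T)$ has trivial kernel, dense range, and bounded inverse $\mathrm{Ran}\,\mathcal Q_s(T)\to\mathcal D(T^2)$; $\sigma_S(T)=\mathbb R^{n+1}\setminus\rho_S(T)$. A set $\Omega\subseteq\mathbb R^{n+1}$ is axially symmetric if $u+v\mathfrak I\in\Omega$ ($u,v\in\mathbb R$, $\mathfrak I\in\mathbb S$) implies $u+v\mathfrak J\in\Omega$ for all $\mathfrak J\in\mathbb S$. A function $f$ on an axially symmetric set $\Omega$ is intrinsic if $f(u+\mathfrak Iv)=f_0(u,v)+\mathfrak If_1(u,v)$ for all $u+\mathfrak Iv\in\Omega$, $\mathfrak I\in\mathbb S$, with real-valued $f_0,f_1$ satisfying $f_0(u,-v)=f_0(u,v)$ and $f_1(u,-v)=-f_1(u,v)$. A function on $\Omega_{\mathfrak I}^+$ is intrinsic if it is the restriction of an intrinsic function on an axially symmetric $\Omega$ with $\Omega\cap\mathbb C_{\mathfrak I}^+=\Omega_{\mathfrak I}^+$. A spectral measure on a $\sigma$-algebra $\mathscr A$ of subsets of $\Omega$ is a map $E$ from $\mathscr A$ to orthogonal projections on $\mathcal H_n$ that is countably additive (in the strong operator topology) with $E(\Omega)=I$. $J$ is associated with $E$ if $JE(M)=E(M)J$ for all $M\in\mathscr A$. For a simple function $f=\sum_jc_j\chi_{M_j}$ (disjoint $M_j$, $c_j\in\mathbb C_{\mathfrak I}$), $\mathbb I(f)=\sum_j\{\mathrm{Re}(c_j)E(M_j)+\mathrm{Im}(c_j)E(M_j)J\}$;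 for bounded measurable $f$, $\mathbb I(f)$ is the operator norm limit of $\mathbb I(f_j)$ for simple $f_j\to f$ uniformly; for measurable $E$-a.e. finite $f:\Omega\to\mathbb C_{\mathfrak I}\cup\{\infty\}$, $\mathcal D(\mathbb I(f))=\{x:\int_\Omega|f|^2\,d(\mathrm{Re}\langle E(\lambda)x,x\rangle)<\infty\}$ and $\mathbb I(f)x=\lim_j\mathbb I(f\chi_{M_j})x$, for any sequence $M_j\subseteq M_{j+1}$ in $\mathscr A$ with $f$ bounded on each $M_j$ and $E(\cup_jM_j)=I$. *)

theory Defs
  imports "HOL-Analysis.Analysis"
begin

section \<open>The Clifford algebra and Clifford modules\<close>

text \<open>
  The generators are indexed by a finite linearly ordered type \<open>'n\<close>, so that \<open>n = CARD('n) \<ge> 1\<close>,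
  and the basis by the subsets of \<open>'n\<close>. An element of \<open>H \<otimes> R\<^sub>n\<close> is the vector of
  its coefficients; \<open>H = R\<close> gives the algebra itself. The norm of \<^typ>\<open>'h ^ 'i\<close> is the Euclidean
  one, as required. The library's \<open>*\<close> and \<open>1\<close> on vectors are componentwise
  and are never used here: the Clifford product is \<open>\<odot>\<close>, with unit \<open>cl_one\<close>.
\<close>

type_synonym 'n cliff = "real ^ ('n set)"
type_synonym ('h, 'n) cmod = "'h ^ ('n set)"

text \<open>
  Moving the factors of \<open>e\<^sub>\<beta>\<close> into place in \<open>e\<^sub>\<alpha> e\<^sub>\<beta>\<close> costs one sign for each pair \<open>i \<in> \<alpha>\<close>, \<open>j \<in> \<beta>\<close>
  with \<open>j < i\<close>, and \<open>e\<^sub>i\<^sup>2 = -1\<close> costs one for each \<open>i = j\<close>.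
\<close>

definition cl_sign :: "'n::{finite,linorder} set \<Rightarrow> 'n set \<Rightarrow> real" where
  "cl_sign \<alpha> \<beta> = (- 1) ^ card {(i, j). i \<in> \<alpha> \<and> j \<in> \<beta> \<and> j \<le> i}"

definition cl_basis :: "'n::finite set \<Rightarrow> 'n cliff" where
  "cl_basis \<alpha> = axis \<alpha> 1"

abbreviation cl_one :: "'n::finite cliff" where
  "cl_one \<equiv> cl_basis {}"

abbreviation cl_gen :: "'n::finite \<Rightarrow> 'n cliff" where
  "cl_gen i \<equiv> cl_basis {i}"

text \<open>
  Right multiplication on \<open>H \<otimes> R\<^sub>n\<close>, which for \<open>H = R\<close> is the product of the algebra.
\<close>

definition cl_mul ::
  "('h::real_vector, 'n::{finite,linorder}) cmod \<Rightarrow> 'n cliff \<Rightarrow> ('h, 'n) cmod" (infixl "\<odot>" 70) where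
  "x \<odot> a = (\<Sum>\<alpha>\<in>UNIV. \<Sum>\<beta>\<in>UNIV.
      axis (sym_diff \<alpha> \<beta>) ((cl_sign \<alpha> \<beta> * a $ \<beta>) *\<^sub>R x $ \<alpha>))"

definition cl_Re :: "'n::finite cliff \<Rightarrow> real" where
  "cl_Re a = a $ {}"

text \<open>
  Conjugation inverts each basis element, and \<open>e\<^sub>\<alpha>\<^sup>2 = cl_sign \<alpha> \<alpha>\<close>.
\<close>

definition cl_conj :: "'n::{finite,linorder} cliff \<Rightarrow> 'n cliff" where
  "cl_conj a = (\<chi> \<alpha>. cl_sign \<alpha> \<alpha> * a $ \<alpha>)"

definition cl_inner ::
  "('h::real_inner, 'n::{finite,linorder}) cmod \<Rightarrow> ('h, 'n) cmod \<Rightarrow> 'n cliff" where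
  "cl_inner x y = (\<Sum>\<alpha>\<in>UNIV. \<Sum>\<beta>\<in>UNIV.
      (x $ \<alpha> \<bullet> y $ \<beta>) *\<^sub>R (cl_conj (cl_basis \<beta>) \<odot> cl_basis \<alpha>))"

subsection \<open>The model satisfies the defining properties of the algebra\<close>

lemma cl_sign_eq_prod:
  "cl_sign \<alpha> \<beta> = (\<Prod>i\<in>\<alpha>. \<Prod>j\<in>\<beta>. if j \<le> i then - 1 else 1)"
proof -
  have "(\<Prod>i\<in>\<alpha>. \<Prod>j\<in>\<beta>. if j \<le> i then - 1 else (1::real))
      = (\<Prod>p\<in>\<alpha> \<times> \<beta>. if snd p \<le> fst p then - 1 else 1)"
    by (simp add: prod.cartesian_product case_prod_beta)
  also have "\<dots> = (\<Prod>p\<in>{p \<in> \<alpha> \<times> \<beta>. snd p \<le> fst p}. - 1)"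
    by (rule prod.mono_neutral_cong_right) auto
  also have "\<dots> = (- 1) ^ card {p \<in> \<alpha> \<times> \<beta>. snd p \<le> fst p}"
    by simp
  also have "{p \<in> \<alpha> \<times> \<beta>. snd p \<le> fst p} = {(i, j). i \<in> \<alpha> \<and> j \<in> \<beta> \<and> j \<le> i}"
    by auto
  finally show ?thesis
    by (simp add: cl_sign_def)
qed

lemma prod_sym_diff:
  fixes g :: "'a::finite \<Rightarrow> real"
  assumes "\<And>i. g i * g i = 1"
  shows "prod g (sym_diff \<alpha> \<beta>) = prod g \<alpha> * prod g \<beta>"
proof -
  have a: "prod g \<alpha> = prod g (\<alpha> - \<beta>) * prod g (\<alpha> \<inter> \<beta>)"
    by (subst prod.union_disjoint[symmetric]) (auto intro: arg_cong[where f = "prod g"])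
  have b: "prod g \<beta> = prod g (\<beta> - \<alpha>) * prod g (\<alpha> \<inter> \<beta>)"
    by (subst prod.union_disjoint[symmetric]) (auto intro: arg_cong[where f = "prod g"])
  have c: "prod g (\<alpha> \<inter> \<beta>) * prod g (\<alpha> \<inter> \<beta>) = 1"
    by (simp add: prod.distrib[symmetric] assms)
  have d: "prod g (sym_diff \<alpha> \<beta>) = prod g (\<alpha> - \<beta>) * prod g (\<beta> - \<alpha>)"
    by (rule prod.union_disjoint) auto
  have "prod g \<alpha> * prod g \<beta>
      = prod g (\<alpha> - \<beta>) * prod g (\<beta> - \<alpha>) * (prod g (\<alpha> \<inter> \<beta>) * prod g (\<alpha> \<inter> \<beta>))"
    by (simp add: a b)
  then show ?thesis
    by (simp add: c d)
qed

lemma cl_sign_square: "cl_sign \<alpha> \<beta> * cl_sign \<alpha> \<beta> = 1"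
  by (simp add: cl_sign_def power_mult_distrib[symmetric])

lemma cl_sign_sym_diff_left: "cl_sign (sym_diff \<alpha> \<beta>) \<gamma> = cl_sign \<alpha> \<gamma> * cl_sign \<beta> \<gamma>"
  unfolding cl_sign_eq_prod
  by (rule prod_sym_diff) (auto simp: prod.distrib[symmetric] intro!: prod.neutral)

lemma cl_sign_sym_diff_right: "cl_sign \<gamma> (sym_diff \<alpha> \<beta>) = cl_sign \<gamma> \<alpha> * cl_sign \<gamma> \<beta>"
proof -
  have "(\<Prod>j\<in>sym_diff \<alpha> \<beta>. if j \<le> i then - 1 else (1::real))
      = (\<Prod>j\<in>\<alpha>. if j \<le> i then - 1 else 1) * (\<Prod>j\<in>\<beta>. if j \<le> i then - 1 else 1)" for i
    by (rule prod_sym_diff) simp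
  then show ?thesis
    unfolding cl_sign_eq_prod by (simp add: prod.distrib)
qed

lemma eq_sym_diff_iff: "\<gamma> = sym_diff \<alpha> \<beta> \<longleftrightarrow> \<beta> = sym_diff \<alpha> \<gamma>"
  by auto

lemma cl_mul_nth:
  "(x \<odot> a) $ \<gamma>
    = (\<Sum>\<alpha>\<in>UNIV. (cl_sign \<alpha> (sym_diff \<alpha> \<gamma>) * a $ sym_diff \<alpha> \<gamma>) *\<^sub>R x $ \<alpha>)"
proof -
  have "(\<Sum>\<beta>\<in>UNIV. axis (sym_diff \<alpha> \<beta>) ((cl_sign \<alpha> \<beta> * a $ \<beta>) *\<^sub>R x $ \<alpha>) $ \<gamma>)
      = (cl_sign \<alpha> (sym_diff \<alpha> \<gamma>) * a $ sym_diff \<alpha> \<gamma>) *\<^sub>R x $ \<alpha>" for \<alpha>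
  proof -
    have "(\<Sum>\<beta>\<in>UNIV. axis (sym_diff \<alpha> \<beta>) ((cl_sign \<alpha> \<beta> * a $ \<beta>) *\<^sub>R x $ \<alpha>) $ \<gamma>)
        = (\<Sum>\<beta>\<in>UNIV. if \<beta> = sym_diff \<alpha> \<gamma>
            then (cl_sign \<alpha> \<beta> * a $ \<beta>) *\<^sub>R x $ \<alpha> else 0)"
      by (simp only: axis_def vec_lambda_beta eq_sym_diff_iff[of \<gamma> \<alpha>])
    then show ?thesis
      by (simp only: sum.delta finite UNIV_I if_True)
  qed
  then show ?thesis
    by (simp only: cl_mul_def sum_component)
qed

lemma cl_basis_mul: "cl_basis \<alpha> \<odot> cl_basis \<beta> = cl_sign \<alpha> \<beta> *\<^sub>R cl_basis (sym_diff \<alpha> \<beta>)"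
proof (rule vec_eq_iff[THEN iffD2], rule allI)
  fix \<gamma>
  have "(cl_basis \<alpha> \<odot> cl_basis \<beta>) $ \<gamma> = (\<Sum>\<alpha>'\<in>UNIV. if \<alpha>' = \<alpha>
      then cl_sign \<alpha> (sym_diff \<alpha> \<gamma>) * cl_basis \<beta> $ sym_diff \<alpha> \<gamma> else 0)"
    unfolding cl_mul_nth by (rule sum.cong) (auto simp: cl_basis_def axis_def)
  also have "\<dots> = cl_sign \<alpha> (sym_diff \<alpha> \<gamma>) * cl_basis \<beta> $ sym_diff \<alpha> \<gamma>"
    by (simp only: sum.delta finite UNIV_I if_True)
  also have "\<dots> = (cl_sign \<alpha> \<beta> *\<^sub>R cl_basis (sym_diff \<alpha> \<beta>)) $ \<gamma>"
  proof (cases "\<gamma> = sym_diff \<alpha> \<beta>")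
    case True
    then have "sym_diff \<alpha> \<gamma> = \<beta>"
      by auto
    then show ?thesis
      by (simp only: True cl_basis_def axis_def vec_lambda_beta vector_scaleR_component
          simp_thms if_True real_scaleR_def)
  next
    case False
    then have "sym_diff \<alpha> \<gamma> \<noteq> \<beta>"
      by auto
    with False show ?thesis
      by (simp only: cl_basis_def axis_def vec_lambda_beta vector_scaleR_component
          if_False real_scaleR_def mult_zero_right)
  qed
  finally show "(cl_basis \<alpha> \<odot> cl_basis \<beta>) $ \<gamma> = (cl_sign \<alpha> \<beta> *\<^sub>R cl_basis (sym_diff \<alpha> \<beta>)) $ \<gamma>" .
qed

lemma cl_gen_square: "cl_gen i \<odot> cl_gen i = - cl_one"
proof -
  have "{(k, j). k \<in> {i} \<and> j \<in> {i} \<and> j \<le> k} = {(i, i)}"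
    by auto
  then show ?thesis
    by (simp add: cl_basis_mul cl_sign_def)
qed

lemma cl_gen_anticommute:
  assumes "i \<noteq> j"
  shows "cl_gen i \<odot> cl_gen j = - (cl_gen j \<odot> cl_gen i)"
proof -
  have "{(k, l). k \<in> {i} \<and> l \<in> {j} \<and> l \<le> k} = (if j \<le> i then {(i, j)} else {})" for i j :: 'a
    by auto
  moreover have "sym_diff {i} {j} = sym_diff {j} {i}"
    by auto
  ultimately show ?thesis
    using assms by (auto simp: cl_basis_mul cl_sign_def)
qed

lemma cl_basis_insert:
  assumes "\<And>j. j \<in> \<alpha> \<Longrightarrow> i < j"
  shows "cl_basis (insert i \<alpha>) = cl_gen i \<odot> cl_basis \<alpha>"
proof -
  have "cl_sign {i} \<alpha> = 1"
    unfolding cl_sign_eq_prod by (intro prod.neutral ballI) (use assms in force)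
  moreover have "sym_diff {i} \<alpha> = insert i \<alpha>"
    using assms by fastforce
  ultimately show ?thesis
    by (simp only: cl_basis_mul scaleR_one)
qed

lemma cl_mul_one [simp]: "x \<odot> cl_one = x"
proof (rule vec_eq_iff[THEN iffD2], rule allI)
  fix \<gamma>
  have "(x \<odot> cl_one) $ \<gamma> = (\<Sum>\<alpha>\<in>UNIV. if \<alpha> = \<gamma> then x $ \<alpha> else 0)"
    unfolding cl_mul_nth
    by (rule sum.cong) (auto simp: cl_basis_def axis_def cl_sign_def)
  then show "(x \<odot> cl_one) $ \<gamma> = x $ \<gamma>"
    by simp
qed

lemma sym_diff_sym_diff: "sym_diff \<alpha> (sym_diff \<alpha> \<beta>) = \<beta>"
  by auto

lemma sum_sym_diff: "(\<Sum>\<beta>\<in>UNIV. g (sym_diff \<alpha> \<beta>)) = sum g (UNIV :: 'n::finite set set)"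
  by (rule sum.reindex_bij_witness[of _ "sym_diff \<alpha>" "sym_diff \<alpha>"])
     (simp_all only: sym_diff_sym_diff UNIV_I)

lemma cl_mul_assoc: "x \<odot> a \<odot> b = x \<odot> (a \<odot> b)"
proof (rule vec_eq_iff[THEN iffD2], rule allI)
  fix \<gamma>
  define F where "F \<alpha> \<beta> = (cl_sign \<beta> (sym_diff \<beta> \<gamma>) * b $ sym_diff \<beta> \<gamma>
      * (cl_sign \<alpha> (sym_diff \<alpha> \<beta>) * a $ sym_diff \<alpha> \<beta>)) *\<^sub>R x $ \<alpha>" for \<alpha> \<beta>
  have *: "F \<alpha> (sym_diff \<alpha> \<beta>) = (cl_sign \<alpha> (sym_diff \<alpha> \<gamma>) * (cl_sign \<beta> (sym_diff \<beta> (sym_diff \<alpha> \<gamma>))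
      * b $ sym_diff \<beta> (sym_diff \<alpha> \<gamma>) * a $ \<beta>)) *\<^sub>R x $ \<alpha>" for \<alpha> \<beta>
  proof -
    define \<delta> where "\<delta> = sym_diff \<beta> (sym_diff \<alpha> \<gamma>)"
    have e: "sym_diff (sym_diff \<alpha> \<beta>) \<gamma> = \<delta>" "sym_diff \<alpha> \<gamma> = sym_diff \<beta> \<delta>"
      by (auto simp: \<delta>_def)
    show ?thesis
      unfolding F_def sym_diff_sym_diff \<delta>_def[symmetric] e(1)
      unfolding e(2)
      by (simp only: cl_sign_sym_diff_left cl_sign_sym_diff_right mult_ac)
  qed
  have "(x \<odot> a \<odot> b) $ \<gamma> = (\<Sum>\<beta>\<in>UNIV. \<Sum>\<alpha>\<in>UNIV. F \<alpha> \<beta>)"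
    by (simp only: cl_mul_nth scaleR_sum_right scaleR_scaleR F_def)
  also have "\<dots> = (\<Sum>\<alpha>\<in>UNIV. \<Sum>\<beta>\<in>UNIV. F \<alpha> \<beta>)"
    by (rule sum.swap)
  also have "\<dots> = (\<Sum>\<alpha>\<in>UNIV. \<Sum>\<beta>\<in>UNIV. F \<alpha> (sym_diff \<alpha> \<beta>))"
    by (intro sum.cong refl sum_sym_diff[symmetric])
  also have "\<dots> = (x \<odot> (a \<odot> b)) $ \<gamma>"
    by (simp only: * cl_mul_nth scaleR_sum_left sum_distrib_left real_scaleR_def)
  finally show "(x \<odot> a \<odot> b) $ \<gamma> = (x \<odot> (a \<odot> b)) $ \<gamma>" .
qed

lemma cl_conj_one: "cl_conj cl_one = cl_one"
  by (simp add: vec_eq_iff cl_conj_def cl_basis_def axis_def cl_sign_def)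

lemma cl_conj_gen: "cl_conj (cl_gen i) = - cl_gen i"
proof -
  have "{(k, j). k \<in> {i} \<and> j \<in> {i} \<and> j \<le> k} = {(i, i)}"
    by auto
  then show ?thesis
    by (simp add: vec_eq_iff cl_conj_def cl_basis_def axis_def cl_sign_def)
qed

lemma cl_conj_mul:
  fixes a b :: "'n::{finite,linorder} cliff"
  shows "cl_conj (a \<odot> b) = cl_conj b \<odot> cl_conj a"
proof (rule vec_eq_iff[THEN iffD2], rule allI)
  fix \<gamma> :: "'n set"
  have *: "cl_sign \<gamma> \<gamma> * cl_sign \<alpha> \<beta> = cl_sign \<beta> \<alpha> * cl_sign \<alpha> \<alpha> * cl_sign \<beta> \<beta>"
    if "\<gamma> = sym_diff \<alpha> \<beta>" for \<alpha> \<beta>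
  proof -
    have "cl_sign \<gamma> \<gamma> * cl_sign \<alpha> \<beta> = (cl_sign \<alpha> \<beta> * cl_sign \<alpha> \<beta>)
        * (cl_sign \<beta> \<alpha> * cl_sign \<alpha> \<alpha> * cl_sign \<beta> \<beta>)"
      by (simp only: that cl_sign_sym_diff_left cl_sign_sym_diff_right mult_ac)
    then show ?thesis
      by (simp only: cl_sign_square mult_1_left)
  qed
  have "cl_conj (a \<odot> b) $ \<gamma> = (\<Sum>\<alpha>\<in>UNIV.
      cl_sign \<gamma> \<gamma> * cl_sign \<alpha> (sym_diff \<alpha> \<gamma>) * (b $ sym_diff \<alpha> \<gamma> * a $ \<alpha>))"
    by (simp only: cl_conj_def vec_lambda_beta cl_mul_nth sum_distrib_left real_scaleR_def mult.assoc)
  also have "\<dots> = (\<Sum>\<alpha>\<in>UNIV. cl_sign (sym_diff \<alpha> \<gamma>) \<alpha> * cl_sign \<alpha> \<alpha>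
      * cl_sign (sym_diff \<alpha> \<gamma>) (sym_diff \<alpha> \<gamma>) * (b $ sym_diff \<alpha> \<gamma> * a $ \<alpha>))"
    by (rule sum.cong[OF refl], subst *) (simp_all only: sym_diff_sym_diff)
  also have "\<dots> = (\<Sum>\<beta>\<in>UNIV. cl_sign \<beta> (sym_diff \<beta> \<gamma>) * cl_sign (sym_diff \<beta> \<gamma>) (sym_diff \<beta> \<gamma>)
      * cl_sign \<beta> \<beta> * (b $ \<beta> * a $ sym_diff \<beta> \<gamma>))"
  proof -
    have "sym_diff (sym_diff \<alpha> \<gamma>) \<gamma> = \<alpha>" for \<alpha>
      by auto
    then show ?thesis
      by (intro sum.reindex_bij_witness[of _ "\<lambda>\<alpha>. sym_diff \<alpha> \<gamma>" "\<lambda>\<alpha>. sym_diff \<alpha> \<gamma>"])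
         (simp_all only: UNIV_I)
  qed
  also have "\<dots> = (cl_conj b \<odot> cl_conj a) $ \<gamma>"
    by (simp only: cl_conj_def vec_lambda_beta cl_mul_nth real_scaleR_def mult_ac)
  finally show "cl_conj (a \<odot> b) $ \<gamma> = (cl_conj b \<odot> cl_conj a) $ \<gamma>" .
qed

section \<open>Paravectors and intrinsic functions\<close>

definition paravectors :: "'n::finite cliff set" where
  "paravectors = {s. \<forall>\<alpha>. card \<alpha> > 1 \<longrightarrow> s $ \<alpha> = 0}"

definition imag_sphere :: "'n::finite cliff set" where
  "imag_sphere = {\<Sum>j\<in>UNIV. c j *\<^sub>R cl_gen j | c. (\<Sum>j\<in>UNIV. (c j)\<^sup>2) = 1}"

definition cplane :: "'n::finite cliff \<Rightarrow> 'n cliff set" where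
  "cplane \<II> = {u *\<^sub>R cl_one + v *\<^sub>R \<II> | u v. True}"

definition cplane_upper :: "'n::finite cliff \<Rightarrow> 'n cliff set" where
  "cplane_upper \<II> = {u *\<^sub>R cl_one + v *\<^sub>R \<II> | u v. v \<ge> 0}"

text \<open>
  The imaginary part of a point of \<open>cplane \<II>\<close>, namely its coefficient along the unit vector \<open>\<II>\<close>.
\<close>

definition cplane_Im :: "'n::finite cliff \<Rightarrow> 'n cliff \<Rightarrow> real" where
  "cplane_Im \<II> c = c \<bullet> \<II>"

lemma imag_sphere_nth:
  assumes "\<II> \<in> imag_sphere"
  shows "\<II> $ {} = 0" "\<II> \<bullet> \<II> = 1"
proof -
  obtain c where c: "\<II> = (\<Sum>j\<in>UNIV. c j *\<^sub>R cl_gen j)" "(\<Sum>j\<in>UNIV. (c j)\<^sup>2) = 1"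
    using assms by (auto simp: imag_sphere_def)
  show "\<II> $ {} = 0"
    by (simp add: c(1) cl_basis_def axis_def)
  have "\<II> \<bullet> \<II> = (\<Sum>i\<in>UNIV. \<Sum>j\<in>UNIV. if j = i then (c i)\<^sup>2 else 0)"
    unfolding c(1) inner_sum_left inner_sum_right
    by (intro sum.cong refl) (auto simp: cl_basis_def inner_axis_axis power2_eq_square)
  then show "\<II> \<bullet> \<II> = 1"
    using c(2) by simp
qed

lemma cplane_Re_Im:
  fixes \<II> :: "'n::finite cliff"
  assumes "\<II> \<in> imag_sphere"
  shows "cl_Re (u *\<^sub>R cl_one + v *\<^sub>R \<II>) = u"
    and "cplane_Im \<II> (u *\<^sub>R cl_one + v *\<^sub>R \<II>) = v"
proof -
  have "cl_one \<bullet> \<II> = 0"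
    using imag_sphere_nth(1)[OF assms] by (simp add: cl_basis_def inner_axis')
  moreover have "(cl_one :: 'n cliff) $ {} = 1"
    by (simp add: cl_basis_def axis_def)
  ultimately show "cl_Re (u *\<^sub>R cl_one + v *\<^sub>R \<II>) = u" "cplane_Im \<II> (u *\<^sub>R cl_one + v *\<^sub>R \<II>) = v"
    using imag_sphere_nth[OF assms] by (simp_all add: cl_Re_def cplane_Im_def inner_add_left)
qed

definition axially_symmetric :: "'n::finite cliff set \<Rightarrow> bool" where
  "axially_symmetric \<Omega> \<longleftrightarrow> \<Omega> \<subseteq> paravectors \<and>
     (\<forall>u v. \<forall>\<II>\<in>imag_sphere. u *\<^sub>R cl_one + v *\<^sub>R \<II> \<in> \<Omega> \<longrightarrow>
        (\<forall>\<JJ>\<in>imag_sphere. u *\<^sub>R cl_one + v *\<^sub>R \<JJ> \<in> \<Omega>))"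

definition intrinsic :: "'n::finite cliff set \<Rightarrow> ('n cliff \<Rightarrow> 'n cliff) \<Rightarrow> bool" where
  "intrinsic \<Omega> f \<longleftrightarrow> axially_symmetric \<Omega> \<and>
     (\<exists>f0 f1 :: real \<Rightarrow> real \<Rightarrow> real.
        (\<forall>u v. f0 u (- v) = f0 u v \<and> f1 u (- v) = - f1 u v) \<and>
        (\<forall>u v. \<forall>\<II>\<in>imag_sphere. u *\<^sub>R cl_one + v *\<^sub>R \<II> \<in> \<Omega> \<longrightarrow>
           f (u *\<^sub>R cl_one + v *\<^sub>R \<II>) = f0 u v *\<^sub>R cl_one + f1 u v *\<^sub>R \<II>))"

text \<open>
  Functions with values in \<open>cplane \<II> \<union> {\<infinity>}\<close> are option valued, with \<^term>\<open>None\<close> for \<open>\<infinity>\<close>, as in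
  \<^const>\<open>Alexandroff_compactification\<close>. Since \<open>\<infinity>\<close> is not of the form \<open>f\<^sub>0 + \<II> f\<^sub>1\<close>, an extended
  function is intrinsic if its domain is axially symmetric and it is infinite on whole spheres
  and intrinsic where it is finite.
\<close>

definition intrinsic_ext :: "'n::finite cliff set \<Rightarrow> ('n cliff \<Rightarrow> 'n cliff option) \<Rightarrow> bool" where
  "intrinsic_ext \<Omega> f \<longleftrightarrow> axially_symmetric \<Omega> \<and>
     intrinsic {s \<in> \<Omega>. f s \<noteq> None} (\<lambda>s. the (f s))"

definition intrinsic_on_half ::
  "'n::finite cliff \<Rightarrow> 'n cliff set \<Rightarrow> ('n cliff \<Rightarrow> 'n cliff option) \<Rightarrow> bool" where
  "intrinsic_on_half \<II> \<Omega>\<^sub>p f \<longleftrightarrow>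
     (\<exists>\<Omega> g. \<Omega> \<inter> cplane_upper \<II> = \<Omega>\<^sub>p \<and> intrinsic_ext \<Omega> g \<and> (\<forall>z\<in>\<Omega>\<^sub>p. f z = g z))"

definition cplane_infty :: "'n::finite cliff \<Rightarrow> 'n cliff option measure" where
  "cplane_infty \<II> =
     (let X = Alexandroff_compactification (top_of_set (cplane \<II>))
      in sigma (topspace X) {U. openin X U})"

section \<open>Operators and the S-spectrum\<close>

definition right_linear_bounded ::
  "(('h::real_inner, 'n::{finite,linorder}) cmod \<Rightarrow>\<^sub>L ('h, 'n) cmod) \<Rightarrow> bool" where
  "right_linear_bounded T \<longleftrightarrow> (\<forall>x a. T (x \<odot> a) = T x \<odot> a)"

definition is_adjoint ::
  "(('h::real_inner, 'n::{finite,linorder}) cmod \<Rightarrow>\<^sub>L ('h, 'n) cmod) \<Rightarrow>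
   (('h, 'n) cmod \<Rightarrow>\<^sub>L ('h, 'n) cmod) \<Rightarrow> bool" where
  "is_adjoint T S \<longleftrightarrow> (\<forall>x y. cl_inner (T x) y = cl_inner x (S y))"

definition unitary_op ::
  "(('h::real_inner, 'n::{finite,linorder}) cmod \<Rightarrow>\<^sub>L ('h, 'n) cmod) \<Rightarrow> bool" where
  "unitary_op U \<longleftrightarrow> right_linear_bounded U \<and>
     (\<exists>V. right_linear_bounded V \<and> is_adjoint U V \<and> U o\<^sub>L V = id_blinfun \<and> V o\<^sub>L U = id_blinfun)"

definition imaginary_op ::
  "(('h::real_inner, 'n::{finite,linorder}) cmod \<Rightarrow>\<^sub>L ('h, 'n) cmod) \<Rightarrow> bool" where
  "imaginary_op J \<longleftrightarrow> unitary_op J \<and> is_adjoint J (- J)"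

definition orthogonal_projection ::
  "(('h::real_inner, 'n::{finite,linorder}) cmod \<Rightarrow>\<^sub>L ('h, 'n) cmod) \<Rightarrow> bool" where
  "orthogonal_projection P \<longleftrightarrow> right_linear_bounded P \<and> is_adjoint P P \<and> P o\<^sub>L P = P"

text \<open>
  An operator with a domain; the values of the function outside the domain are irrelevant.
\<close>

datatype 'v operator = Operator (op_dom: "'v set") (op_app: "'v \<Rightarrow> 'v")

definition Q_op ::
  "('h::real_inner, 'n::finite) cmod operator \<Rightarrow> 'n cliff \<Rightarrow> ('h, 'n) cmod operator" where
  "Q_op T s = Operator {x \<in> op_dom T. op_app T x \<in> op_dom T}
     (\<lambda>x. op_app T (op_app T x) - (2 * cl_Re s) *\<^sub>R op_app T x + (norm s)\<^sup>2 *\<^sub>R x)"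

definition S_resolvent_set :: "('h::real_inner, 'n::finite) cmod operator \<Rightarrow> 'n cliff set" where
  "S_resolvent_set T = {s \<in> paravectors.
     let D = op_dom (Q_op T s); Q = op_app (Q_op T s) in
       {x \<in> D. Q x = 0} = {0} \<and>
       closure (Q ` D) = UNIV \<and>
       (\<exists>C. \<forall>y\<in>Q ` D. norm (inv_into D Q y) \<le> C * norm y)}"

definition S_spectrum :: "('h::real_inner, 'n::finite) cmod operator \<Rightarrow> 'n cliff set" where
  "S_spectrum T = paravectors - S_resolvent_set T"

section \<open>Spectral measures and spectral integrals\<close>

text \<open>
  Here \<open>M\<close> only carries the underlying set and \<open>\<sigma>\<close>-algebra.
\<close>

definition spectral_measure ::
  "'a measure \<Rightarrow> ('a set \<Rightarrow>
     (('h::real_inner, 'n::{finite,linorder}) cmod \<Rightarrow>\<^sub>L ('h, 'n) cmod)) \<Rightarrow> bool" where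
  "spectral_measure M E \<longleftrightarrow>
     (\<forall>A\<in>sets M. orthogonal_projection (E A)) \<and>
     (\<forall>A :: nat \<Rightarrow> 'a set. range A \<subseteq> sets M \<longrightarrow> disjoint_family A \<longrightarrow>
        (\<forall>x. (\<lambda>i. E (A i) x) sums E (\<Union>i. A i) x)) \<and>
     E (space M) = id_blinfun"

definition associated ::
  "'a measure \<Rightarrow> ('a set \<Rightarrow> ('v::real_normed_vector \<Rightarrow>\<^sub>L 'v)) \<Rightarrow> ('v \<Rightarrow>\<^sub>L 'v) \<Rightarrow> bool" where
  "associated M E J \<longleftrightarrow> (\<forall>A\<in>sets M. J o\<^sub>L E A = E A o\<^sub>L J)"

definition scalar_measure ::
  "'a measure \<Rightarrow> ('a set \<Rightarrow> (('h::real_inner, 'n::{finite,linorder}) cmod \<Rightarrow>\<^sub>L ('h, 'n) cmod)) \<Rightarrow>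
   ('h, 'n) cmod \<Rightarrow> 'a measure" where
  "scalar_measure M E x =
     measure_of (space M) (sets M) (\<lambda>A. ennreal (cl_Re (cl_inner (E A x) x)))"

text \<open>
  The integrals depend on \<open>\<II>\<close> through the meaning of the imaginary part.
\<close>

definition integral_simple ::
  "'n::finite cliff \<Rightarrow> 'a measure \<Rightarrow> ('a set \<Rightarrow> ('v::real_normed_vector \<Rightarrow>\<^sub>L 'v)) \<Rightarrow> ('v \<Rightarrow>\<^sub>L 'v) \<Rightarrow>
   ('a \<Rightarrow> 'n cliff) \<Rightarrow> ('v \<Rightarrow>\<^sub>L 'v)" where
  "integral_simple \<II> M E J f = (\<Sum>c\<in>f ` space M.
     cl_Re c *\<^sub>R E (f -` {c} \<inter> space M) + cplane_Im \<II> c *\<^sub>R (E (f -` {c} \<inter> space M) o\<^sub>L J))"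

definition integral_bounded ::
  "'n::finite cliff \<Rightarrow> 'a measure \<Rightarrow> ('a set \<Rightarrow> ('v::real_normed_vector \<Rightarrow>\<^sub>L 'v)) \<Rightarrow> ('v \<Rightarrow>\<^sub>L 'v) \<Rightarrow>
   ('a \<Rightarrow> 'n cliff) \<Rightarrow> ('v \<Rightarrow>\<^sub>L 'v)" where
  "integral_bounded \<II> M E J f = (THE A. \<exists>g :: nat \<Rightarrow> 'a \<Rightarrow> 'n cliff.
     (\<forall>j. simple_function M (g j) \<and> g j ` space M \<subseteq> cplane \<II>) \<and>
     uniform_limit (space M) g f sequentially \<and>
     (\<lambda>j. integral_simple \<II> M E J (g j)) \<longlonglongrightarrow> A)"

definition spectral_integral ::
  "'n::{finite,linorder} cliff \<Rightarrow> 'a measure \<Rightarrow>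
   ('a set \<Rightarrow> (('h::real_inner, 'n) cmod \<Rightarrow>\<^sub>L ('h, 'n) cmod)) \<Rightarrow> (('h, 'n) cmod \<Rightarrow>\<^sub>L ('h, 'n) cmod) \<Rightarrow>
   ('a \<Rightarrow> 'n cliff option) \<Rightarrow> ('h, 'n) cmod operator" where
  "spectral_integral \<II> M E J f = Operator
     {x. (\<integral>\<^sup>+z. (case f z of None \<Rightarrow> \<infinity> | Some c \<Rightarrow> ennreal ((norm c)\<^sup>2)) \<partial>scalar_measure M E x) < \<infinity>}
     (\<lambda>x. THE y. \<exists>B :: nat \<Rightarrow> 'a set.
        (\<forall>j. B j \<in> sets M \<and> B j \<subseteq> B (Suc j) \<and>
           (\<exists>C. \<forall>z\<in>B j. \<exists>c. f z = Some c \<and> norm c \<le> C)) \<and>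
        E (\<Union>j. B j) = id_blinfun \<and>
        (\<lambda>j. integral_bounded \<II> M E J (\<lambda>z. if z \<in> B j then the (f z) else 0) x) \<longlonglongrightarrow> y)"

end

theory Submission
  imports Defs
begin

text \<open>
  The operator \<open>\<bbbI>(f)\<close> is determined by its bounded truncations: for the level sets
  \<open>L\<^sub>k = {|f| \<le> k}\<close>, the pair \<open>(x, y)\<close> lies in its graph iff \<open>E(L\<^sub>k) y = \<bbbI>(f \<chi>\<^bsub>L\<^sub>k\<^esub>) x\<close> for all \<open>k\<close>.
  Put \<open>p = f\<^sup>2 - 2 Re(s) f + |s|\<^sup>2\<close>. On \<open>E(L\<^sub>k)\<close> the operator \<open>\<Q>\<^sub>s(\<bbbI>(f))\<close> acts as the bounded operator
  \<open>\<bbbI>(p \<chi>\<^bsub>L\<^sub>k\<^esub>)\<close>. If \<open>E({|p| < \<epsilon>}) = 0\<close>, the integrals of \<open>\<chi>\<^bsub>L\<^sub>k\<^esub>/p\<close>, all of norm at most \<open>1/\<epsilon>\<close>, give the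
  lower bound and the dense range. Conversely, \<open>\<Q>\<^sub>s(\<bbbI>(f))\<close> has norm at most \<open>\<epsilon>\<close> on the range of
  \<open>E({|p| < \<epsilon>} \<inter> L\<^sub>k)\<close>, so a lower bound \<open>1/C\<close> forces this range to be trivial once \<open>C \<epsilon> < 1\<close>.
  Values in \<open>\<complex>\<^sub>\<II>\<close> are treated as complex numbers, with \<open>J\<close> as multiplication by the imaginary unit.
\<close>

section \<open>The bounded functional calculus\<close>

text \<open>The calculus lives on a real Hilbert space: of the Clifford structure it keeps only the
  real inner product. Squaring to minus the identity and skewness make J an imaginary unit, and
  commuting with E lets complex functions be integrated.\<close>

locale spectral_calculus =
  fixes M :: "'a measure"
    and E :: "'a set \<Rightarrow> ('v::{real_inner,banach} \<Rightarrow>\<^sub>L 'v)"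
    and J :: "'v \<Rightarrow>\<^sub>L 'v"
  assumes E_adjoint: "A \<in> sets M \<Longrightarrow> E A x \<bullet> y = x \<bullet> E A y"
    and E_idem: "A \<in> sets M \<Longrightarrow> E A (E A x) = E A x"
    and E_sums: "range D \<subseteq> sets M \<Longrightarrow> disjoint_family D \<Longrightarrow> (\<lambda>i::nat. E (D i) x) sums E (\<Union>i. D i) x"
    and E_space: "E (space M) = id_blinfun"
    and J_J: "J (J x) = - x"
    and J_skew: "J x \<bullet> y = - (x \<bullet> J y)"
    and J_E: "A \<in> sets M \<Longrightarrow> J (E A x) = E A (J x)"
begin

section \<open>Projections of a spectral measure: products, null sets and monotone limits\<close>

lemma E_empty: "E {} x = 0"
proof -
  have "(\<lambda>i::nat. E {} x) sums E (\<Union>i::nat. {}) x"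
    by (rule E_sums) (auto simp: disjoint_family_on_def)
  \<comment> \<open>The terms of a convergent series tend to 0, and here all terms are the same
    vector.\<close>
  then have "(\<lambda>i::nat. E {} x) \<longlonglongrightarrow> 0"
    by (intro summable_LIMSEQ_zero sums_summable)
  then show ?thesis
    by (simp add: LIMSEQ_const_iff)
qed

lemma E_Un:
  assumes "A \<in> sets M" "B \<in> sets M" "A \<inter> B = {}"
  shows "E (A \<union> B) x = E A x + E B x"
proof -
  have "(\<lambda>i. E (binaryset A B i) x) sums E (\<Union>i. binaryset A B i) x"
    using assms by (intro E_sums) (auto simp: range_binaryset_eq disjoint_family_on_def binaryset_def)
  moreover have "(\<lambda>i. E (binaryset A B i) x) sums (\<Sum>i\<in>{0,1}. E (binaryset A B i) x)"
    by (rule sums_finite) (auto simp: binaryset_def E_empty)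
  ultimately have "E (\<Union>i. binaryset A B i) x = (\<Sum>i\<in>{0,1}. E (binaryset A B i) x)"
    by (rule sums_unique2)
  then show ?thesis
    by (simp add: UN_binaryset_eq binaryset_def)
qed

lemma E_UN_finite:
  assumes "finite I" "\<And>i. i \<in> I \<Longrightarrow> A i \<in> sets M" "disjoint_family_on A I"
  shows "E (\<Union>i\<in>I. A i) x = (\<Sum>i\<in>I. E (A i) x)"
  using assms
proof (induction I rule: finite_induct)
  case empty
  then show ?case by (simp add: E_empty)
next
  case (insert i I)
  have "E (A i \<union> (\<Union>i\<in>I. A i)) x = E (A i) x + E (\<Union>i\<in>I. A i) x"
    using insert by (intro E_Un sets.finite_UN) (auto simp: disjoint_family_on_def)
  with insert show ?case
    by (simp add: disjoint_family_on_def)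
qed

text \<open>Two projections whose sum is a projection have product zero: \<open>PR + RP = 0\<close> forces
  \<open>PR = PPR = - PRP = RPP = RP\<close>.\<close>

lemma E_disjoint:
  assumes "A \<in> sets M" "B \<in> sets M" "A \<inter> B = {}"
  shows "E A (E B x) = 0"
proof -
  have *: "E A (E B y) + E B (E A y) = 0" for y
  proof -
    have "E (A \<union> B) (E (A \<union> B) y) = E (A \<union> B) y"
      using assms by (intro E_idem) auto
    then show ?thesis
      using assms by (simp add: E_Un blinfun.add_right E_idem algebra_simps)
  qed
  have "E A (E B x) = - E A (E B (E A x))"
  proof -
    have "E A (E A (E B x) + E B (E A x)) = 0"
      by (simp add: *)
    then show ?thesis
      using assms(1) by (simp add: blinfun.add_right E_idem eq_neg_iff_add_eq_0)
  qed
  moreover have "E A (E B (E A x)) = - E B (E A x)"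
    using *[of "E A x"] assms(1) by (simp add: E_idem eq_neg_iff_add_eq_0)
  ultimately have "E A (E B x) = E B (E A x)"
    by simp
  with *[of x] have "2 *\<^sub>R E A (E B x) = 0"
    by (simp add: scaleR_2)
  then show ?thesis
    by simp
qed

lemma E_split:
  assumes "A \<in> sets M" "B \<in> sets M"
  shows "E A x = E (A - B) x + E (A \<inter> B) x"
proof -
  have "E ((A - B) \<union> (A \<inter> B)) x = E (A - B) x + E (A \<inter> B) x"
    using assms by (intro E_Un) auto
  moreover have "(A - B) \<union> (A \<inter> B) = A"
    by auto
  ultimately show ?thesis
    by simp
qed

text \<open>Split A and B into the disjoint pieces \<open>A - B\<close>, \<open>A \<inter> B\<close>
  and \<open>B - A\<close>. By \<open>E_disjoint\<close> the only product of pieces that survives is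
  the square of \<open>E (A \<inter> B)\<close>.\<close>

lemma E_Int:
  assumes "A \<in> sets M" "B \<in> sets M"
  shows "E (A \<inter> B) x = E A (E B x)"
proof -
  have a: "E A y = E (A - B) y + E (A \<inter> B) y" for y
    by (rule E_split[OF assms])
  have b: "E B x = E (B - A) x + E (A \<inter> B) x"
    using E_split[of B A] assms by (simp add: Int_commute)
  have "E (A - B) (E (B - A) x) = 0" "E (A - B) (E (A \<inter> B) x) = 0"
    "E (A \<inter> B) (E (B - A) x) = 0"
    by (intro E_disjoint; use assms in auto)+
  with assms show ?thesis
    by (simp add: a b blinfun.add_right E_idem)
qed

lemma E_norm_sq: "A \<in> sets M \<Longrightarrow> (norm (E A x))\<^sup>2 = x \<bullet> E A x"
  by (simp add: power2_norm_eq_inner E_adjoint E_idem)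

lemma E_norm_le: "A \<in> sets M \<Longrightarrow> norm (E A x) \<le> norm x"
proof -
  assume A: "A \<in> sets M"
  have "(norm (E A x))\<^sup>2 \<le> norm x * norm (E A x)"
    using E_norm_sq[OF A] norm_cauchy_schwarz by metis
  then show ?thesis
    by (cases "norm (E A x) = 0") (auto simp: power2_eq_square)
qed

text \<open>The part \<open>E (A \<inter> N)\<close> factors through \<open>E N\<close> and so
  vanishes. This discards the poles of f and the set \<open>quad_lt \<epsilon>\<close> when its
  projection is zero.\<close>

lemma E_null_Diff:
  assumes "A \<in> sets M" "N \<in> sets M" "E N = 0"
  shows "E (A - N) = E A"
proof (rule blinfun_eqI)
  fix x
  have "E A x = E (A - N) x + E (A \<inter> N) x"
    by (rule E_split[OF assms(1,2)])
  also have "E (A \<inter> N) x = E N (E A x)"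
    using E_Int[of N A] assms by (simp add: Int_commute)
  finally show "E (A - N) x = E A x"
    using assms by simp
qed

text \<open>Continuity from below in the strong topology: countable additivity for the disjointed
  sequence gives a series whose partial sum up to and including index n is
  \<open>E (B n) x\<close>.\<close>

lemma E_incseq_LIMSEQ:
  assumes "\<And>i. B i \<in> sets M" "\<And>i. B i \<subseteq> B (Suc i)"
  shows "(\<lambda>i. E (B i) x) \<longlonglongrightarrow> E (\<Union>i. B i) x"
proof -
  have inc: "B i \<subseteq> B j" if "i \<le> j" for i j
    using that assms(2) by (rule lift_Suc_mono_le[of B, rotated])
  have "(\<lambda>i. E (disjointed B i) x) sums E (\<Union>i. disjointed B i) x"
    using assms by (intro E_sums sets.range_disjointed_sets disjoint_family_disjointed) auto
  then have "(\<lambda>n. \<Sum>i<Suc n. E (disjointed B i) x) \<longlonglongrightarrow> E (\<Union>i. B i) x"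
    unfolding sums_def UN_disjointed_eq by (rule LIMSEQ_Suc)
  moreover have "(\<Sum>i<Suc n. E (disjointed B i) x) = E (B n) x" for n
  proof -
    have "(\<Sum>i<Suc n. E (disjointed B i) x) = E (\<Union>i\<in>{..<Suc n}. disjointed B i) x"
      using assms sets.range_disjointed_sets[of B M]
      by (intro E_UN_finite[symmetric]) (auto intro: disjoint_family_on_mono[OF _ disjoint_family_disjointed])
    also have "(\<Union>i\<in>{..<Suc n}. disjointed B i) = B n"
      unfolding lessThan_atLeast0 finite_UN_disjointed_eq
      by (auto simp: less_Suc_eq_le dest: subsetD[OF inc])
    finally show ?thesis .
  qed
  ultimately show ?thesis
    by simp
qed

section \<open>The complex structure given by J, and integrals of simple functions\<close>

definition scal :: "complex \<Rightarrow> 'v \<Rightarrow>\<^sub>L 'v" where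
  "scal c = Re c *\<^sub>R id_blinfun + Im c *\<^sub>R J"

lemma scal_apply: "scal c x = Re c *\<^sub>R x + Im c *\<^sub>R J x"
  by (simp add: scal_def blinfun.add_left blinfun.scaleR_left)

lemma scal_diff: "scal (c - d) x = scal c x - scal d x"
  by (simp add: scal_apply algebra_simps)

lemma scal_0: "scal 0 x = 0" and scal_1: "scal 1 x = x"
  by (simp_all add: scal_apply)

lemma scal_mult: "scal (c * d) x = scal c (scal d x)"
  by (simp add: scal_apply blinfun.add_right blinfun.scaleR_right J_J algebra_simps)

lemma scal_E: "A \<in> sets M \<Longrightarrow> E A (scal c x) = scal c (E A x)"
  by (simp add: scal_apply blinfun.add_right blinfun.scaleR_right J_E)

text \<open>Skewness makes x and \<open>J x\<close> orthogonal and, with \<open>J_J\<close>, makes J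
  isometric; Pythagoras does the rest.\<close>

lemma scal_norm_sq: "(norm (scal c x))\<^sup>2 = (cmod c)\<^sup>2 * (norm x)\<^sup>2"
proof -
  have "x \<bullet> J x = 0"
    using J_skew[of x x] by (simp add: inner_commute)
  moreover have "J x \<bullet> J x = x \<bullet> x"
    by (simp add: J_skew J_J)
  moreover have "J x \<bullet> x = x \<bullet> J x"
    by (rule inner_commute)
  ultimately have "scal c x \<bullet> scal c x = (Re c)\<^sup>2 * (x \<bullet> x) + (Im c)\<^sup>2 * (x \<bullet> x)"
    by (simp add: scal_apply inner_add_left inner_add_right power2_eq_square)
  then show ?thesis
    by (simp only: cmod_power2 distrib_right power2_norm_eq_inner)
qed

text \<open>The summands follow \<open>integral_simple\<close> term by term, so that passing between
  Clifford and complex values only reindexes the sum.\<close>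

definition simple_int :: "('a \<Rightarrow> complex) \<Rightarrow> 'v \<Rightarrow>\<^sub>L 'v" where
  "simple_int g = (\<Sum>c\<in>g ` space M.
     Re c *\<^sub>R E (g -` {c} \<inter> space M) + Im c *\<^sub>R (E (g -` {c} \<inter> space M) o\<^sub>L J))"

lemma simple_int_apply:
  assumes "simple_function M g"
  shows "simple_int g x = (\<Sum>c\<in>g ` space M. scal c (E (g -` {c} \<inter> space M) x))"
  unfolding simple_int_def blinfun.sum_left
  by (rule sum.cong)
     (simp_all add: blinfun.add_left blinfun.scaleR_left scal_apply J_E simple_functionD(2)[OF assms])

text \<open>Every fibre of g is a finite disjoint union of fibres of h, so the sum can be refined.
  With h the pair of two simple functions, their integrals become sums over common fibres, which
  yields differences and products.\<close>

lemma simple_int_compose: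
  assumes h: "simple_function M h" and g: "\<And>z. z \<in> space M \<Longrightarrow> g z = F (h z)"
  shows "simple_int g x = (\<Sum>d\<in>h ` space M. scal (F d) (E (h -` {d} \<inter> space M) x))"
proof -
  have "simple_function M g"
    using simple_function_cong[of M g "\<lambda>z. F (h z)"] simple_function_compose1[OF h, of F] g by auto
  moreover have "scal c (E (g -` {c} \<inter> space M) x)
      = (\<Sum>d\<in>{d \<in> h ` space M. F d = c}. scal (F d) (E (h -` {d} \<inter> space M) x))" for c
  proof -
    have "g -` {c} \<inter> space M = (\<Union>d\<in>{d \<in> h ` space M. F d = c}. h -` {d} \<inter> space M)"
      using g by auto
    moreover have "E (\<Union>d\<in>{d \<in> h ` space M. F d = c}. h -` {d} \<inter> space M) x
        = (\<Sum>d\<in>{d \<in> h ` space M. F d = c}. E (h -` {d} \<inter> space M) x)"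
      using simple_functionD[OF h]
      by (intro E_UN_finite) (auto simp: disjoint_family_on_def)
    ultimately show ?thesis
      by (simp add: blinfun.sum_right)
  qed
  ultimately have "simple_int g x
      = (\<Sum>c\<in>g ` space M. \<Sum>d\<in>{d \<in> h ` space M. F d = c}. scal (F d) (E (h -` {d} \<inter> space M) x))"
    by (simp add: simple_int_apply)
  also have "\<dots> = (\<Sum>d\<in>h ` space M. scal (F d) (E (h -` {d} \<inter> space M) x))"
  proof (rule sum.group)
    have "g ` space M = F ` h ` space M"
      unfolding image_image using g by (rule image_cong[OF refl])
    then show "finite (g ` space M)" "F ` h ` space M \<subseteq> g ` space M"
      using simple_functionD(1)[OF h] by simp_all
  qed (rule simple_functionD(1)[OF h])
  finally show ?thesis .
qed

lemma simple_int_diff: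
  assumes "simple_function M g" "simple_function M h"
  shows "simple_int (\<lambda>z. g z - h z) = simple_int g - simple_int h"
proof (rule blinfun_eqI)
  fix x
  let ?p = "\<lambda>z. (g z, h z)"
  have p: "simple_function M ?p"
    using assms by simp
  show "simple_int (\<lambda>z. g z - h z) x = (simple_int g - simple_int h) x"
    by (simp add: simple_int_compose[OF p, of _ "\<lambda>d. fst d - snd d"] simple_int_compose[OF p, of _ fst]
        simple_int_compose[OF p, of _ snd] blinfun.diff_left scal_diff sum_subtractf)
qed

lemma E_fibres:
  assumes "simple_function M p" "d \<noteq> e"
  shows "E (p -` {d} \<inter> space M) (E (p -` {e} \<inter> space M) x) = 0"
  using assms by (intro E_disjoint simple_functionD(2)) auto

text \<open>Over the common fibres of the pair, projections of different fibres annihilate each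
  other, so only the diagonal of the double sum remains.\<close>

lemma simple_int_mult:
  assumes "simple_function M g" "simple_function M h"
  shows "simple_int (\<lambda>z. g z * h z) = simple_int g o\<^sub>L simple_int h"
proof (rule blinfun_eqI)
  fix x
  let ?p = "\<lambda>z. (g z, h z)" and ?R = "(\<lambda>z. (g z, h z)) ` space M"
  let ?F = "\<lambda>d. ?p -` {d} \<inter> space M"
  have p: "simple_function M ?p"
    using assms by simp
  have fin: "finite ?R" and meas: "?F d \<in> sets M" for d
    using simple_functionD[OF p] by auto
  have "simple_int g (simple_int h x)
      = (\<Sum>d\<in>?R. \<Sum>e\<in>?R. scal (fst d) (scal (snd e) (E (?F d) (E (?F e) x))))"
    by (simp add: simple_int_compose[OF p, of _ fst] simple_int_compose[OF p, of _ snd]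
        blinfun.sum_right scal_E meas) (rule sum.swap)
  also have "\<dots> = (\<Sum>d\<in>?R. \<Sum>e\<in>?R. if d = e then scal (fst d) (scal (snd d) (E (?F d) x)) else 0)"
    by (intro sum.cong refl) (auto simp: E_fibres[OF p] E_idem[OF meas])
  also have "\<dots> = (\<Sum>d\<in>?R. scal (fst d * snd d) (E (?F d) x))"
    by (simp add: fin scal_mult)
  also have "\<dots> = simple_int (\<lambda>z. g z * h z) x"
    by (simp add: simple_int_compose[OF p, of _ "\<lambda>d. fst d * snd d"])
  finally show "simple_int (\<lambda>z. g z * h z) x = (simple_int g o\<^sub>L simple_int h) x"
    by simp
qed

lemma simple_int_indicator:
  assumes "A \<in> sets M"
  shows "simple_int (\<lambda>z. c * indicator A z) = scal c o\<^sub>L E A"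
proof (rule blinfun_eqI)
  fix x
  have h: "simple_function M (indicator A :: 'a \<Rightarrow> complex)"
    by (rule simple_function_indicator[OF assms])
  have A: "A \<subseteq> space M"
    using assms sets.sets_into_space by auto
  have "simple_int (\<lambda>z. c * indicator A z) x = (\<Sum>d\<in>(indicator A :: 'a \<Rightarrow> complex) ` space M.
      scal (c * d) (E ((indicator A :: 'a \<Rightarrow> complex) -` {d} \<inter> space M) x))"
    by (rule simple_int_compose[OF h]) simp
  \<comment> \<open>The value set is normalised to {1} in two moves. Inserting 1, which is missing
    when A is empty, adds an empty fibre; dropping 0 afterwards loses a term with scalar 0.\<close>
  also have "\<dots> = (\<Sum>d\<in>(indicator A :: 'a \<Rightarrow> complex) ` space M \<union> {1}.
      scal (c * d) (E ((indicator A :: 'a \<Rightarrow> complex) -` {d} \<inter> space M) x))"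
  proof (rule sum.mono_neutral_left)
    show "\<forall>i\<in>(indicator A ` space M \<union> {1}) - indicator A ` space M.
       scal (c * i) (E ((indicator A :: 'a \<Rightarrow> complex) -` {i} \<inter> space M) x) = 0"
    proof
      fix i assume "i \<in> (indicator A ` space M \<union> {1}) - (indicator A :: 'a \<Rightarrow> complex) ` space M"
      then have "(indicator A :: 'a \<Rightarrow> complex) -` {i} \<inter> space M = {}"
        by auto
      then show "scal (c * i) (E ((indicator A :: 'a \<Rightarrow> complex) -` {i} \<inter> space M) x) = 0"
        by (simp only: E_empty blinfun.zero_right)
    qed
  qed (use simple_functionD(1)[OF h] in auto)
  also have "\<dots> = (\<Sum>d\<in>{1}. scal (c * d) (E ((indicator A :: 'a \<Rightarrow> complex) -` {d} \<inter> space M) x))"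
  proof (rule sum.mono_neutral_right)
    have "d = 0" if "d \<in> (indicator A ` space M \<union> {1}) - {1 :: complex}" for d
      using that by (auto simp: indicator_def split: if_splits)
    then show "\<forall>d\<in>(indicator A ` space M \<union> {1}) - {1}.
        scal (c * d) (E ((indicator A :: 'a \<Rightarrow> complex) -` {d} \<inter> space M) x) = 0"
      by (metis mult_zero_right scal_0)
  qed (use simple_functionD(1)[OF h] in auto)
  also have "\<dots> = scal c (E A x)"
  proof -
    have "(indicator A :: 'a \<Rightarrow> complex) -` {1} \<inter> space M = A"
      using A by (auto simp: indicator_def)
    then show ?thesis by simp
  qed
  finally show "simple_int (\<lambda>z. c * indicator A z) x = (scal c o\<^sub>L E A) x"
    by simp
qed

text \<open>The projections of different fibres have orthogonal ranges, and \<open>scal\<close>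
  commutes with them, so Pythagoras applies to the summands.\<close>

lemma simple_int_norm_sq:
  assumes g: "simple_function M g"
  shows "(norm (simple_int g x))\<^sup>2 = (\<Sum>c\<in>g ` space M. (cmod c)\<^sup>2 * (norm (E (g -` {c} \<inter> space M) x))\<^sup>2)"
proof -
  let ?F = "\<lambda>c. g -` {c} \<inter> space M"
  have meas: "?F c \<in> sets M" for c
    using simple_functionD[OF g] by auto
  have "pairwise (\<lambda>c d. orthogonal (scal c (E (?F c) x)) (scal d (E (?F d) x))) (g ` space M)"
    unfolding pairwise_def orthogonal_def
  proof safe
    fix y z assume "g y \<noteq> g z"
    have "scal (g y) (E (?F (g y)) x) \<bullet> scal (g z) (E (?F (g z)) x)
        = scal (g y) x \<bullet> E (?F (g y)) (E (?F (g z)) (scal (g z) x))"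
      by (simp only: scal_E[OF meas, symmetric] E_adjoint[OF meas])
    then show "scal (g y) (E (?F (g y)) x) \<bullet> scal (g z) (E (?F (g z)) x) = 0"
      using \<open>g y \<noteq> g z\<close> by (simp add: E_fibres[OF g])
  qed
  then show ?thesis
    unfolding simple_int_apply[OF g]
    by (subst norm_sum_Pythagorean) (auto simp: simple_functionD(1)[OF g] scal_norm_sq pairwise_image)
qed

lemma simple_int_norm_le:
  assumes g: "simple_function M g" and le: "\<And>z. z \<in> space M \<Longrightarrow> cmod (g z) \<le> C" and "C \<ge> 0"
  shows "norm (simple_int g) \<le> C"
proof (rule norm_blinfun_bound[OF \<open>C \<ge> 0\<close>])
  fix x
  let ?F = "\<lambda>c. g -` {c} \<inter> space M"
  have "(norm (simple_int g x))\<^sup>2 \<le> (\<Sum>c\<in>g ` space M. C\<^sup>2 * (norm (E (?F c) x))\<^sup>2)"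
    unfolding simple_int_norm_sq[OF g]
    by (intro sum_mono mult_right_mono power_mono) (auto intro: le)
  \<comment> \<open>Written as \<open>x \<bullet> E A x\<close>, the squared norm is additive in A;
    the fibres partition the space, so the sum collapses to the squared norm of x.\<close>
  also have "\<dots> = C\<^sup>2 * (x \<bullet> (\<Sum>c\<in>g ` space M. E (?F c) x))"
    by (simp add: inner_sum_right E_norm_sq simple_functionD[OF g] sum_distrib_left)
  also have "(\<Sum>c\<in>g ` space M. E (?F c) x) = E (\<Union>c\<in>g ` space M. ?F c) x"
    using simple_functionD[OF g]
    by (intro E_UN_finite[symmetric]) (auto simp: disjoint_family_on_def)
  also have "(\<Union>c\<in>g ` space M. ?F c) = space M" by auto
  finally have "(norm (simple_int g x))\<^sup>2 \<le> (C * norm x)\<^sup>2"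
    by (simp add: E_space power_mult_distrib power2_norm_eq_inner)
  then show "norm (simple_int g x) \<le> C * norm x"
    by (rule power2_le_imp_le) (use \<open>C \<ge> 0\<close> in simp)
qed

section \<open>Integrals of bounded measurable functions\<close>

definition has_bdd_int :: "('a \<Rightarrow> complex) \<Rightarrow> ('v \<Rightarrow>\<^sub>L 'v) \<Rightarrow> bool" where
  "has_bdd_int g A \<longleftrightarrow> (\<exists>gs. (\<forall>j. simple_function M (gs j)) \<and>
     uniform_limit (space M) gs g sequentially \<and> (\<lambda>j. simple_int (gs j)) \<longlonglongrightarrow> A)"

lemma has_bdd_int_diff:
  assumes "has_bdd_int g A" "has_bdd_int h B"
  shows "has_bdd_int (\<lambda>z. g z - h z) (A - B)"
proof -
  obtain gs hs where "\<And>j. simple_function M (gs j)" "uniform_limit (space M) gs g sequentially"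
    "(\<lambda>j. simple_int (gs j)) \<longlonglongrightarrow> A" "\<And>j. simple_function M (hs j)"
    "uniform_limit (space M) hs h sequentially" "(\<lambda>j. simple_int (hs j)) \<longlonglongrightarrow> B"
    using assms unfolding has_bdd_int_def by blast
  then show ?thesis
    unfolding has_bdd_int_def
    by (intro exI[of _ "\<lambda>j z. gs j z - hs j z"] conjI allI)
       (auto simp: simple_int_diff intro!: uniform_limit_minus tendsto_diff simple_function_diff)
qed

text \<open>Boundedness of g and h is what makes the products of the approximants converge
  uniformly.\<close>

lemma has_bdd_int_mult:
  assumes "has_bdd_int g A" "has_bdd_int h B" "bounded (g ` space M)" "bounded (h ` space M)"
  shows "has_bdd_int (\<lambda>z. g z * h z) (A o\<^sub>L B)"
proof -
  obtain gs hs where "\<And>j. simple_function M (gs j)" "uniform_limit (space M) gs g sequentially"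
    "(\<lambda>j. simple_int (gs j)) \<longlonglongrightarrow> A" "\<And>j. simple_function M (hs j)"
    "uniform_limit (space M) hs h sequentially" "(\<lambda>j. simple_int (hs j)) \<longlonglongrightarrow> B"
    using assms unfolding has_bdd_int_def by blast
  then show ?thesis
    unfolding has_bdd_int_def
    by (intro exI[of _ "\<lambda>j z. gs j z * hs j z"] conjI allI)
       (auto simp: simple_int_mult assms
         intro!: bounded_bilinear.bounded_uniform_limit[OF bounded_bilinear_mult] simple_function_mult
           bounded_bilinear.tendsto[OF bounded_bilinear_blinfun_compose])
qed

text \<open>Approximants uniformly within e of g are bounded by C + e, hence so are their integrals
  eventually, and the limit inherits the bound for every e.\<close>

lemma has_bdd_int_norm_le:
  assumes "has_bdd_int g A" and le: "\<And>z. z \<in> space M \<Longrightarrow> cmod (g z) \<le> C" and "C \<ge> 0"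
  shows "norm A \<le> C"
proof (rule field_le_epsilon)
  fix e :: real assume e: "e > 0"
  obtain gs where gs: "\<And>j. simple_function M (gs j)" "uniform_limit (space M) gs g sequentially"
    "(\<lambda>j. simple_int (gs j)) \<longlonglongrightarrow> A"
    using assms unfolding has_bdd_int_def by blast
  have "\<forall>\<^sub>F j in sequentially. \<forall>z\<in>space M. dist (gs j z) (g z) < e"
    using gs(2) e by (rule uniform_limitD)
  then have "\<forall>\<^sub>F j in sequentially. norm (simple_int (gs j)) \<le> C + e"
  proof eventually_elim
    case (elim j)
    show ?case
    proof (rule simple_int_norm_le[OF gs(1)])
      fix z assume z: "z \<in> space M"
      have "cmod (gs j z) \<le> cmod (g z) + dist (gs j z) (g z)"
        using norm_triangle_sub[of "gs j z" "g z"] by (simp add: dist_norm)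
      with elim le[OF z] z show "cmod (gs j z) \<le> C + e"
        by force
    qed (use e assms in simp)
  qed
  then show "norm A \<le> C + e"
    by (rule Lim_norm_ubound[OF sequentially_bot gs(3)])
qed

text \<open>\<open>A - B\<close> is an integral of the zero function, so the norm bound with C = 0
  applies: the limit does not depend on the approximating sequence.\<close>

lemma has_bdd_int_unique:
  assumes "has_bdd_int g A" "has_bdd_int g B"
  shows "A = B"
  using has_bdd_int_norm_le[OF has_bdd_int_diff[OF assms], of 0] by simp

lemma has_bdd_int_simple: "simple_function M g \<Longrightarrow> has_bdd_int g (simple_int g)"
  unfolding has_bdd_int_def by (intro exI[of _ "\<lambda>_. g"]) (auto intro: uniform_limit_const)

text \<open>Round real and imaginary parts down to multiples of 1/(j+1). Each coordinate moves by at
  most 1/(j+1), and boundedness of g confines the numerators to a finite range of integers.\<close>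

lemma uniform_simple_approximation:
  fixes g :: "'a \<Rightarrow> complex"
  assumes g: "g \<in> borel_measurable M" "bounded (g ` space M)"
  obtains gs where "\<And>j. simple_function M (gs j)" "uniform_limit (space M) gs g sequentially"
proof -
  obtain C where C: "\<And>z. z \<in> space M \<Longrightarrow> cmod (g z) \<le> C"
    using g(2) by (auto simp: bounded_iff)
  define r where "r j x = real_of_int \<lfloor>real (Suc j) * x\<rfloor> / real (Suc j)" for j x
  define gs where "gs j z = Complex (r j (Re (g z))) (r j (Im (g z)))" for j z
  have r: "\<bar>r j x - x\<bar> \<le> 1 / real (Suc j)" for j x
  proof -
    have "r j x - x = (real_of_int \<lfloor>real (Suc j) * x\<rfloor> - real (Suc j) * x) / real (Suc j)"
      by (simp add: r_def field_simps del: of_nat_Suc)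
    also have "\<bar>\<dots>\<bar> \<le> 1 / real (Suc j)"
      unfolding abs_divide by (intro divide_mono) (linarith | simp)+
    finally show ?thesis .
  qed
  show ?thesis
  proof
    fix j
    have [measurable]: "g \<in> borel_measurable M" by (rule g)
    have "gs j = (\<lambda>z. complex_of_real (r j (Re (g z))) + \<i> * complex_of_real (r j (Im (g z))))"
      by (auto simp: gs_def complex_eq_iff)
    also have "\<dots> \<in> borel_measurable M"
      unfolding r_def by measurable
    finally have m: "gs j \<in> borel_measurable M" .
    define K where "K = \<lceil>real (Suc j) * C\<rceil>"
    have *: "r j x \<in> (\<lambda>k. real_of_int k / real (Suc j)) ` {-K..K}" if "\<bar>x\<bar> \<le> C" for x
    proof -
      have "\<bar>real (Suc j) * x\<bar> \<le> real (Suc j) * C"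
        unfolding abs_mult using that by (intro mult_mono) auto
      then have "real (Suc j) * x \<le> K" "- K \<le> real (Suc j) * x"
        unfolding K_def by linarith+
      then have "\<lfloor>real (Suc j) * x\<rfloor> \<in> {-K..K}"
        by (auto simp: le_floor_iff floor_le_iff)
      then show ?thesis
        unfolding r_def by blast
    qed
    have "gs j ` space M \<subseteq> (\<lambda>(a, b). Complex a b) `
        ((\<lambda>k. real_of_int k / real (Suc j)) ` {-K..K} \<times> (\<lambda>k. real_of_int k / real (Suc j)) ` {-K..K})"
      unfolding gs_def using *[OF order_trans[OF abs_Re_le_cmod C]] *[OF order_trans[OF abs_Im_le_cmod C]]
      by (intro subsetI) (clarsimp, blast)
    then have "finite (gs j ` space M)"
      by (rule finite_subset) simp
    with m show "simple_function M (gs j)"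
      by (rule simple_function_borel_measurable)
  next
    show "uniform_limit (space M) gs g sequentially"
    proof (rule uniform_limitI)
      fix e :: real assume "e > 0"
      have "(\<lambda>j. 2 * inverse (real (Suc j))) \<longlonglongrightarrow> 2 * 0"
        by (intro tendsto_mult tendsto_const LIMSEQ_inverse_real_of_nat)
      then have "\<forall>\<^sub>F j in sequentially. 2 * inverse (real (Suc j)) < e"
        by (rule order_tendstoD) (use \<open>e > 0\<close> in simp)
      then show "\<forall>\<^sub>F j in sequentially. \<forall>z\<in>space M. dist (gs j z) (g z) < e"
      proof eventually_elim
        case (elim j)
        show ?case
        proof
          fix z
          have "dist (gs j z) (g z) \<le> \<bar>Re (gs j z - g z)\<bar> + \<bar>Im (gs j z - g z)\<bar>"
            unfolding dist_norm by (rule cmod_le)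
          also have "\<dots> \<le> 2 * inverse (real (Suc j))"
            using r[of j "Re (g z)"] r[of j "Im (g z)"] by (simp add: gs_def divide_inverse)
          finally show "dist (gs j z) (g z) < e"
            using elim by simp
        qed
      qed
    qed
  qed
qed

lemma has_bdd_int_exists:
  assumes g: "g \<in> borel_measurable M" "bounded (g ` space M)"
  obtains A where "has_bdd_int g A"
proof -
  obtain gs where gs: "\<And>j. simple_function M (gs j)" "uniform_limit (space M) gs g sequentially"
    using uniform_simple_approximation[OF g] by blast
  have "Cauchy (\<lambda>j. simple_int (gs j))"
  proof (rule metric_CauchyI)
    fix e :: real assume e: "e > 0"
    then have "\<forall>\<^sub>F j in sequentially. \<forall>z\<in>space M. dist (gs j z) (g z) < e / 4"
      by (intro uniform_limitD[OF gs(2)]) simp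
    then obtain N where N: "\<And>j z. j \<ge> N \<Longrightarrow> z \<in> space M \<Longrightarrow> dist (gs j z) (g z) < e / 4"
      by (auto simp: eventually_sequentially)
    \<comment> \<open>Two approximants within e/4 of g differ by at most e/2 pointwise; applying the
      norm bound to their difference leaves room for the strict inequality.\<close>
    have "dist (simple_int (gs m)) (simple_int (gs n)) < e" if "m \<ge> N" "n \<ge> N" for m n
    proof -
      have "norm (simple_int (\<lambda>z. gs m z - gs n z)) \<le> e / 2"
      proof (rule simple_int_norm_le)
        fix z assume z: "z \<in> space M"
        have "dist (gs m z) (gs n z) \<le> dist (gs m z) (g z) + dist (gs n z) (g z)"
          by (metis dist_commute dist_triangle)
        with N[OF that(1) z] N[OF that(2) z] show "cmod (gs m z - gs n z) \<le> e / 2"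
          by (simp add: dist_norm)
      qed (use gs e in auto)
      with e show ?thesis
        by (simp add: dist_norm simple_int_diff gs)
    qed
    then show "\<exists>N. \<forall>m\<ge>N. \<forall>n\<ge>N. dist (simple_int (gs m)) (simple_int (gs n)) < e"
      by blast
  qed
  then show ?thesis
    using that gs unfolding has_bdd_int_def by (metis Cauchy_convergent convergentD)
qed

text \<open>\<open>has_bdd_int\<close> is a relation so that existence and uniqueness of the limit
  are settled before this description is evaluated.\<close>

definition bdd_int :: "('a \<Rightarrow> complex) \<Rightarrow> 'v \<Rightarrow>\<^sub>L 'v" where
  "bdd_int g = (THE A. has_bdd_int g A)"

lemma bdd_int_eq: "has_bdd_int g A \<Longrightarrow> bdd_int g = A"
  unfolding bdd_int_def by (blast intro: has_bdd_int_unique)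

definition bdd_meas :: "('a \<Rightarrow> complex) \<Rightarrow> bool" where
  "bdd_meas g \<longleftrightarrow> g \<in> borel_measurable M \<and> bounded (g ` space M)"

lemma bdd_measI:
  assumes "g \<in> borel_measurable M" "\<And>z. z \<in> space M \<Longrightarrow> cmod (g z) \<le> C"
  shows "bdd_meas g"
  using assms by (auto simp: bdd_meas_def bounded_iff)

lemma has_bdd_int_bdd_int: "bdd_meas g \<Longrightarrow> has_bdd_int g (bdd_int g)"
  using has_bdd_int_exists bdd_int_eq unfolding bdd_meas_def by metis

lemma bdd_int_diff:
  assumes "bdd_meas g" "bdd_meas h"
  shows "bdd_int (\<lambda>z. g z - h z) = bdd_int g - bdd_int h"
  using assms by (intro bdd_int_eq has_bdd_int_diff has_bdd_int_bdd_int)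

lemma bdd_int_mult:
  assumes "bdd_meas g" "bdd_meas h"
  shows "bdd_int (\<lambda>z. g z * h z) = bdd_int g o\<^sub>L bdd_int h"
  using assms by (intro bdd_int_eq has_bdd_int_mult has_bdd_int_bdd_int) (auto simp: bdd_meas_def)

lemma bdd_meas_diff:
  assumes "bdd_meas g" "bdd_meas h"
  shows "bdd_meas (\<lambda>z. g z - h z)"
  using assms bounded_minus_comp[of g "space M" h] by (auto simp: bdd_meas_def)

lemma bdd_meas_mult:
  assumes "bdd_meas g" "bdd_meas h"
  shows "bdd_meas (\<lambda>z. g z * h z)"
proof -
  obtain C D where "\<And>z. z \<in> space M \<Longrightarrow> cmod (g z) \<le> C" "\<And>z. z \<in> space M \<Longrightarrow> cmod (h z) \<le> D"
    using assms by (auto simp: bdd_meas_def bounded_iff)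
  then show ?thesis
    using assms by (intro bdd_measI[of _ "C * D"])
      (auto simp: bdd_meas_def norm_mult intro!: mult_mono order_trans[OF norm_ge_zero])
qed

lemma bdd_meas_indicator: "A \<in> sets M \<Longrightarrow> bdd_meas (\<lambda>z. c * indicator A z)"
  by (rule bdd_measI[of _ "cmod c"]) (auto simp: norm_mult indicator_def)

lemma bdd_int_indicator:
  assumes "A \<in> sets M"
  shows "bdd_int (\<lambda>z. c * indicator A z) = scal c o\<^sub>L E A"
  using assms
  by (subst simple_int_indicator[symmetric])
     (auto intro!: bdd_int_eq has_bdd_int_simple simple_function_mult)

lemma bdd_int_indicator_1: "A \<in> sets M \<Longrightarrow> bdd_int (indicator A) = E A"
  using bdd_int_indicator[of A 1] by (simp add: blinfun_eqI scal_1)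

lemma bdd_int_norm_le:
  assumes "g \<in> borel_measurable M" "\<And>z. z \<in> space M \<Longrightarrow> cmod (g z) \<le> C" "C \<ge> 0"
  shows "norm (bdd_int g x) \<le> C * norm x"
proof -
  have "norm (bdd_int g) \<le> C"
    using assms by (intro has_bdd_int_norm_le[OF has_bdd_int_bdd_int[OF bdd_measI]]) auto
  then show ?thesis
    by (meson norm_blinfun order_trans mult_right_mono norm_ge_zero)
qed

section \<open>Scalar measures and the isometry of the integral\<close>

definition weight :: "'v \<Rightarrow> 'a measure" where
  "weight x = measure_of (space M) (sets M) (\<lambda>A. ennreal ((norm (E A x))\<^sup>2))"

lemma space_weight [simp]: "space (weight x) = space M"
  and sets_weight [measurable_cong, simp]: "sets (weight x) = sets M"
  by (simp_all add: weight_def sets.space_closed)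

text \<open>By \<open>E_norm_sq\<close> the squared norm equals \<open>x \<bullet> E A x\<close>,
  which is linear in the vector \<open>E A x\<close> and so inherits countable additivity from
  E.\<close>

lemma emeasure_weight:
  assumes "A \<in> sets M"
  shows "emeasure (weight x) A = ennreal ((norm (E A x))\<^sup>2)"
  unfolding weight_def
proof (rule emeasure_measure_of_sigma)
  show "sigma_algebra (space M) (sets M)"
    by (rule sets.sigma_algebra_axioms)
  show "positive (sets M) (\<lambda>A. ennreal ((norm (E A x))\<^sup>2))"
    by (simp add: positive_def E_empty)
  show "countably_additive (sets M) (\<lambda>A. ennreal ((norm (E A x))\<^sup>2))"
  proof (rule countably_additiveI)
    fix D :: "nat \<Rightarrow> 'a set"
    assume D: "range D \<subseteq> sets M" "disjoint_family D" "(\<Union>i. D i) \<in> sets M"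
    have "(\<lambda>i. x \<bullet> E (D i) x) sums (x \<bullet> E (\<Union>i. D i) x)"
      by (rule bounded_linear.sums[OF bounded_linear_inner_right E_sums[OF D(1,2)]])
    then have "(\<lambda>i. (norm (E (D i) x))\<^sup>2) sums ((norm (E (\<Union>i. D i) x))\<^sup>2)"
      using D by (subst (1 2) E_norm_sq) auto
    then show "(\<Sum>i. ennreal ((norm (E (D i) x))\<^sup>2)) = ennreal ((norm (E (\<Union>i. D i) x))\<^sup>2)"
      by (intro suminf_ennreal_eq) auto
  qed
qed (rule assms)

lemma finite_measure_weight: "finite_measure (weight x)"
  by (rule finite_measureI) (simp add: emeasure_weight E_space)

lemma measure_weight: "A \<in> sets M \<Longrightarrow> measure (weight x) A = (norm (E A x))\<^sup>2"
  by (simp add: measure_def emeasure_weight)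

lemma simple_int_isometry:
  assumes g: "simple_function M g"
  shows "(norm (simple_int g x))\<^sup>2 = (\<integral>z. (cmod (g z))\<^sup>2 \<partial>weight x)"
proof -
  interpret finite_measure "weight x" by (rule finite_measure_weight)
  let ?F = "\<lambda>c. g -` {c} \<inter> space M"
  have "(\<integral>z. (cmod (g z))\<^sup>2 \<partial>weight x)
      = (\<integral>z. (\<Sum>c\<in>g ` space M. (cmod c)\<^sup>2 * indicator (?F c) z) \<partial>weight x)"
  proof (rule Bochner_Integration.integral_cong[OF refl])
    fix z assume z: "z \<in> space (weight x)"
    have "(\<Sum>c\<in>g ` space M. (cmod c)\<^sup>2 * indicator (?F c) z)
        = (\<Sum>c\<in>g ` space M. if c = g z then (cmod c)\<^sup>2 else (0::real))"
      using z by (intro sum.cong) (auto simp: indicator_def)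
    then show "(cmod (g z))\<^sup>2 = (\<Sum>c\<in>g ` space M. (cmod c)\<^sup>2 * indicator (?F c) z)"
      using z simple_functionD(1)[OF g] by simp
  qed
  also have "\<dots> = (\<Sum>c\<in>g ` space M. (cmod c)\<^sup>2 * measure (weight x) (?F c))"
    using simple_functionD(2)[OF g]
    by (subst Bochner_Integration.integral_sum) (auto simp: less_top[symmetric])
  finally show ?thesis
    using simple_functionD(2)[OF g] by (simp add: measure_weight simple_int_norm_sq[OF g])
qed

text \<open>Pass to the limit in the identity for simple functions: by dominated convergence for the
  scalar integrals, by operator norm convergence for the vectors.\<close>

lemma bdd_int_isometry:
  assumes g: "bdd_meas g"
  shows "(\<integral>\<^sup>+z. ennreal ((cmod (g z))\<^sup>2) \<partial>weight x) = ennreal ((norm (bdd_int g x))\<^sup>2)"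
proof -
  interpret finite_measure "weight x" by (rule finite_measure_weight)
  obtain gs where gs: "\<And>j. simple_function M (gs j)" "uniform_limit (space M) gs g sequentially"
    "(\<lambda>j. simple_int (gs j)) \<longlonglongrightarrow> bdd_int g"
    using has_bdd_int_bdd_int[OF g] unfolding has_bdd_int_def by blast
  obtain C where C: "\<And>z. z \<in> space M \<Longrightarrow> cmod (g z) \<le> C"
    using g by (auto simp: bdd_meas_def bounded_iff)
  have "\<forall>\<^sub>F j in sequentially. \<forall>z\<in>space M. dist (gs j z) (g z) < 1"
    by (rule uniform_limitD[OF gs(2)]) simp
  \<comment> \<open>From N on the approximants stay within 1 of g, so \<open>(C + 1)\<^sup>2\<close>
    dominates their squares; shifting by N makes this hold for every term.\<close>
  then obtain N where N: "\<And>j z. j \<ge> N \<Longrightarrow> z \<in> space M \<Longrightarrow> dist (gs j z) (g z) < 1"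
    by (auto simp: eventually_sequentially)
  have gM [measurable]: "g \<in> borel_measurable M" and gsM [measurable]: "\<And>j. gs j \<in> borel_measurable M"
    using g gs(1) by (auto simp: bdd_meas_def intro: borel_measurable_simple_function)
  have int: "integrable (weight x) (\<lambda>z. (cmod (g z))\<^sup>2)"
    by (rule integrable_const_bound[of _ "C\<^sup>2"]) (auto intro!: AE_I2 power_mono C)
  have "(\<lambda>j. \<integral>z. (cmod (gs (j + N) z))\<^sup>2 \<partial>weight x) \<longlonglongrightarrow> (\<integral>z. (cmod (g z))\<^sup>2 \<partial>weight x)"
  proof (rule integral_dominated_convergence[where w = "\<lambda>_. (C + 1)\<^sup>2"])
    show "AE z in weight x. (\<lambda>j. (cmod (gs (j + N) z))\<^sup>2) \<longlonglongrightarrow> (cmod (g z))\<^sup>2"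
    proof (rule AE_I2)
      fix z assume "z \<in> space (weight x)"
      then have "(\<lambda>j. gs j z) \<longlonglongrightarrow> g z"
        by (intro tendsto_uniform_limitI[OF gs(2)]) simp
      then show "(\<lambda>j. (cmod (gs (j + N) z))\<^sup>2) \<longlonglongrightarrow> (cmod (g z))\<^sup>2"
        by (intro tendsto_intros LIMSEQ_ignore_initial_segment)
    qed
    show "AE z in weight x. norm ((cmod (gs (j + N) z))\<^sup>2) \<le> (C + 1)\<^sup>2" for j
    proof (rule AE_I2)
      fix z assume z: "z \<in> space (weight x)"
      then have "cmod (gs (j + N) z) \<le> C + 1"
        using norm_triangle_sub[of "gs (j + N) z" "g z"] N[of "j + N" z] C[of z] by (simp add: dist_norm)
      then show "norm ((cmod (gs (j + N) z))\<^sup>2) \<le> (C + 1)\<^sup>2"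
        by (simp add: power_mono)
    qed
  qed (use gM gsM in measurable)
  moreover have "(\<lambda>j. (norm (simple_int (gs (j + N)) x))\<^sup>2) \<longlonglongrightarrow> (norm (bdd_int g x))\<^sup>2"
    by (intro tendsto_intros LIMSEQ_ignore_initial_segment[where f = "\<lambda>j. simple_int (gs j)", OF gs(3)])
  ultimately have "(\<integral>z. (cmod (g z))\<^sup>2 \<partial>weight x) = (norm (bdd_int g x))\<^sup>2"
    by (simp add: simple_int_isometry[OF gs(1)] LIMSEQ_unique)
  with int show ?thesis
    by (simp add: nn_integral_eq_integral)
qed

text \<open>Multiplicativity with one factor an indicator. The order of the pointwise product is
  irrelevant, so the projection may stand on either side.\<close>

lemma bdd_int_restrict:
  assumes "bdd_meas h" "B \<in> sets M"
  shows "bdd_int (\<lambda>z. h z * indicator B z) x = bdd_int h (E B x)"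
    and "bdd_int (\<lambda>z. h z * indicator B z) x = E B (bdd_int h x)"
proof -
  have B: "bdd_meas (indicator B)"
    using bdd_meas_indicator[of B 1] assms by simp
  show "bdd_int (\<lambda>z. h z * indicator B z) x = bdd_int h (E B x)"
    using bdd_int_mult[OF assms(1) B] assms by (simp add: bdd_int_indicator_1)
  show "bdd_int (\<lambda>z. h z * indicator B z) x = E B (bdd_int h x)"
    using bdd_int_mult[OF B assms(1)] assms by (simp add: bdd_int_indicator_1 mult.commute)
qed

end

section \<open>The integral of an unbounded function\<close>

locale spectral_function = spectral_calculus M E J
  for M :: "'a measure"
    and E :: "'a set \<Rightarrow> ('v::{real_inner,banach} \<Rightarrow>\<^sub>L 'v)"
    and J :: "'v \<Rightarrow>\<^sub>L 'v" +
  fixes g :: "'a \<Rightarrow> complex"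
  assumes g_meas [measurable]: "g \<in> borel_measurable M"
begin

section \<open>Level sets, truncations and the graph of the unbounded integral\<close>

definition lev :: "nat \<Rightarrow> 'a set" where
  "lev k = {z \<in> space M. cmod (g z) \<le> real k}"

definition trunc :: "nat \<Rightarrow> 'v \<Rightarrow>\<^sub>L 'v" where
  "trunc k = bdd_int (\<lambda>z. g z * indicator (lev k) z)"

text \<open>The graph of the integral of the unbounded function \<open>g\<close>, as \<open>y\<close> is the limit of its
  compressions \<open>E (lev k) y\<close>.\<close>

definition graph :: "'v \<Rightarrow> 'v \<Rightarrow> bool" where
  "graph x y \<longleftrightarrow> (\<forall>k. E (lev k) y = trunc k x)"

lemma lev_sets [measurable]: "lev k \<in> sets M"
  unfolding lev_def by measurable

lemma lev_mono: "k \<le> l \<Longrightarrow> lev k \<subseteq> lev l"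
  by (auto simp: lev_def)

lemma lev_Int: "lev k \<inter> lev l = lev (min k l)"
  by (auto simp: lev_def min_def)

lemma UN_lev: "(\<Union>k. lev k) = space M"
  unfolding lev_def by (auto intro: real_arch_simple)

lemma E_lev_LIMSEQ: "(\<lambda>k. E (lev k) x) \<longlonglongrightarrow> x"
  using E_incseq_LIMSEQ[of lev x] by (simp add: lev_mono UN_lev E_space)

text \<open>A vector is the limit of its compressions to the level sets, so identities between
  vectors can be checked level by level.\<close>

lemma E_lev_eqI:
  assumes "\<And>k. E (lev k) x = E (lev k) y"
  shows "x = y"
  using E_lev_LIMSEQ[of x] E_lev_LIMSEQ[of y] assms by (simp add: LIMSEQ_unique)

lemma bdd_meas_g:
  assumes "A \<in> sets M" "\<And>z. z \<in> A \<Longrightarrow> cmod (g z) \<le> C"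
  shows "bdd_meas (\<lambda>z. g z * indicator A z)"
  by (rule bdd_measI[of _ "\<bar>C\<bar>"]) (use assms in \<open>auto simp: indicator_def intro: order_trans[OF _ abs_ge_self]\<close>)

lemma bdd_meas_lev: "bdd_meas (\<lambda>z. g z * indicator (lev k) z)"
  by (rule bdd_meas_g[of _ "real k"]) (auto simp: lev_def)

text \<open>Level sets are nested: projecting before or after a truncation cuts g down to the
  smaller of the two.\<close>

lemma trunc_E_lev: "trunc k (E (lev l) x) = trunc (min k l) x"
  and E_lev_trunc: "E (lev l) (trunc k x) = trunc (min k l) x"
  using bdd_int_restrict[OF bdd_meas_lev[of k] lev_sets[of l], of x]
  by (simp_all add: trunc_def mult.assoc lev_Int flip: indicator_inter_arith)

lemma graph_unique: "graph x y \<Longrightarrow> graph x y' \<Longrightarrow> y = y'"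
  by (rule E_lev_eqI) (simp add: graph_def)

lemma graph_LIMSEQ: "graph x y \<Longrightarrow> (\<lambda>k. trunc k x) \<longlonglongrightarrow> y"
  using E_lev_LIMSEQ[of y] by (simp add: graph_def)

text \<open>A vector supported on one level set is in the domain, and its image is supported there
  too. The operator can thus be applied twice, as the quadratic polynomial requires.\<close>

lemma graph_trunc:
  assumes "E (lev k) x = x"
  shows "graph x (trunc k x)" "E (lev k) (trunc k x) = trunc k x"
proof -
  have "trunc l x = trunc (min k l) x" for l
    using trunc_E_lev[of l k x] assms by (simp add: min.commute)
  then show "graph x (trunc k x)"
    by (simp add: graph_def E_lev_trunc)
  show "E (lev k) (trunc k x) = trunc k x"
    by (simp add: E_lev_trunc)
qed

text \<open>For \<open>k \<le> l\<close>, \<open>trunc k x\<close> is an orthogonal projection of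
  \<open>trunc l x\<close>. The squared norms therefore increase, and their differences are squared
  distances; boundedness makes the truncations Cauchy.\<close>

lemma graph_exists:
  assumes bd: "\<And>k. norm (trunc k x) \<le> C"
  obtains y where "graph x y"
proof -
  let ?n = "\<lambda>k. (norm (trunc k x))\<^sup>2"
  have pyth: "(norm (trunc l x - trunc k x))\<^sup>2 = ?n l - ?n k" if "k \<le> l" for k l
  proof -
    have k: "trunc k x = E (lev k) (trunc l x)"
      using that by (simp add: E_lev_trunc min_absorb2)
    have "trunc l x \<bullet> trunc k x = ?n k"
      unfolding k E_norm_sq[OF lev_sets] ..
    then show ?thesis
      by (simp add: power2_norm_eq_inner inner_diff_left inner_diff_right inner_commute)
  qed
  have "incseq ?n"
  proof (rule monoI)
    fix k l :: nat assume "k \<le> l"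
    with pyth[of k l] show "?n k \<le> ?n l"
      by (metis diff_ge_0_iff_ge zero_le_power2)
  qed
  moreover have "?n k \<le> C\<^sup>2" for k
    by (intro power_mono bd) simp
  ultimately obtain L where L: "?n \<longlonglongrightarrow> L" "\<And>k. ?n k \<le> L"
    using incseq_convergent[of ?n "C\<^sup>2"] by auto
  have "Cauchy (\<lambda>k. trunc k x)"
  proof (rule metric_CauchyI)
    fix e :: real assume e: "e > 0"
    then have "\<forall>\<^sub>F k in sequentially. L - e\<^sup>2 < ?n k"
      by (intro order_tendstoD(1)[OF L(1)]) simp
    then obtain N where N: "\<And>k. k \<ge> N \<Longrightarrow> L - e\<^sup>2 < ?n k"
      by (auto simp: eventually_sequentially)
    have *: "dist (trunc l x) (trunc k x) < e" if "N \<le> k" "k \<le> l" for k l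
    proof -
      have "(norm (trunc l x - trunc k x))\<^sup>2 < e\<^sup>2"
        using pyth[OF that(2)] N[OF that(1)] L(2)[of l] by linarith
      then show ?thesis
        using e by (simp add: dist_norm power2_less_imp_less)
    qed
    have "dist (trunc m x) (trunc n x) < e" if "N \<le> m" "N \<le> n" for m n
      using *[of m n] *[of n m] that by (cases "m \<le> n") (auto simp: dist_commute)
    then show "\<exists>N. \<forall>m\<ge>N. \<forall>n\<ge>N. dist (trunc m x) (trunc n x) < e"
      by blast
  qed
  then obtain y where y: "(\<lambda>k. trunc k x) \<longlonglongrightarrow> y"
    by (meson Cauchy_convergent convergentD)
  \<comment> \<open>Once l reaches k, compressing \<open>trunc l x\<close> to level k gives
    \<open>trunc k x\<close>, so the sequence is eventually constant.\<close>
  have "E (lev k) y = trunc k x" for k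
  proof (rule LIMSEQ_unique)
    show "(\<lambda>l. E (lev k) (trunc l x)) \<longlonglongrightarrow> E (lev k) y"
      by (intro tendsto_intros y)
    show "(\<lambda>l. E (lev k) (trunc l x)) \<longlonglongrightarrow> trunc k x"
      by (rule tendsto_eventually)
         (auto simp: E_lev_trunc min_absorb2 intro: eventually_sequentiallyI[of k])
  qed
  then show ?thesis
    by (intro that[of y]) (simp add: graph_def)
qed

text \<open>Monotone convergence and the isometry express the integral as the supremum of the
  squared norms of the truncations. A graph point bounds these as compressions of y; conversely a
  bound produces y by \<open>graph_exists\<close>.\<close>

lemma graph_domain_iff:
  "(\<exists>y. graph x y) \<longleftrightarrow> (\<integral>\<^sup>+z. ennreal ((cmod (g z))\<^sup>2) \<partial>weight x) < \<infinity>"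
proof -
  let ?h = "\<lambda>k z. ennreal ((cmod (g z * indicator (lev k) z))\<^sup>2)"
  have "(SUP k. ?h k z) = ennreal ((cmod (g z))\<^sup>2)" if "z \<in> space M" for z
  proof (rule antisym)
    show "(SUP k. ?h k z) \<le> ennreal ((cmod (g z))\<^sup>2)"
      by (rule SUP_least) (auto simp: indicator_def)
    obtain k where "z \<in> lev k"
      using \<open>z \<in> space M\<close> UN_lev by blast
    then show "ennreal ((cmod (g z))\<^sup>2) \<le> (SUP k. ?h k z)"
      by (intro SUP_upper2[of k]) auto
  qed
  then have "(\<integral>\<^sup>+z. ennreal ((cmod (g z))\<^sup>2) \<partial>weight x) = (\<integral>\<^sup>+z. (SUP k. ?h k z) \<partial>weight x)"
    by (intro nn_integral_cong) simp
  also have "\<dots> = (SUP k. \<integral>\<^sup>+z. ?h k z \<partial>weight x)"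
  proof (rule nn_integral_monotone_convergence_SUP)
    show "incseq ?h"
    proof (intro incseq_SucI le_funI)
      fix k z
      have "lev k \<subseteq> lev (Suc k)"
        by (rule lev_mono) simp
      then show "?h k z \<le> ?h (Suc k) z"
        by (auto simp: indicator_def)
    qed
  qed simp
  also have "\<dots> = (SUP k. ennreal ((norm (trunc k x))\<^sup>2))"
    by (simp only: bdd_int_isometry[OF bdd_meas_lev] trunc_def)
  finally have eq: "(\<integral>\<^sup>+z. ennreal ((cmod (g z))\<^sup>2) \<partial>weight x) = (SUP k. ennreal ((norm (trunc k x))\<^sup>2))" .
  show ?thesis
  proof
    assume "\<exists>y. graph x y"
    then obtain y where "graph x y" ..
    then have "norm (trunc k x) \<le> norm y" for k
      using E_norm_le[OF lev_sets, of k y] by (simp add: graph_def)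
    then have "(SUP k. ennreal ((norm (trunc k x))\<^sup>2)) \<le> ennreal ((norm y)\<^sup>2)"
      by (intro SUP_least ennreal_leI power_mono) auto
    then show "(\<integral>\<^sup>+z. ennreal ((cmod (g z))\<^sup>2) \<partial>weight x) < \<infinity>"
      unfolding eq by (rule le_less_trans) simp
  next
    assume "(\<integral>\<^sup>+z. ennreal ((cmod (g z))\<^sup>2) \<partial>weight x) < \<infinity>"
    then obtain c where c: "c \<ge> 0" "(SUP k. ennreal ((norm (trunc k x))\<^sup>2)) = ennreal c"
      unfolding eq by (cases "SUP k. ennreal ((norm (trunc k x))\<^sup>2)" rule: ennreal_cases) auto
    have "(norm (trunc k x))\<^sup>2 \<le> c" for k
    proof -
      have "ennreal ((norm (trunc k x))\<^sup>2) \<le> ennreal c"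
        unfolding c(2)[symmetric] by (rule SUP_upper) simp
      with c(1) show ?thesis by simp
    qed
    then have "norm (trunc k x) \<le> sqrt c" for k
      by (rule real_le_rsqrt)
    then show "\<exists>y. graph x y"
      by (rule graph_exists) blast
  qed
qed

text \<open>Shows that the choice of exhausting sequence does not matter: the limit along any
  admissible one is the graph value.\<close>

lemma graph_of_LIMSEQ:
  assumes B: "\<And>j. B j \<in> sets M" "\<And>j. B j \<subseteq> B (Suc j)" "\<And>j. \<exists>C. \<forall>z\<in>B j. cmod (g z) \<le> C"
    "E (\<Union>j. B j) = id_blinfun"
    and lim: "(\<lambda>j. bdd_int (\<lambda>z. g z * indicator (B j) z) x) \<longlonglongrightarrow> y"
  shows "graph x y"
  unfolding graph_def
proof
  fix k
  have meas: "bdd_meas (\<lambda>z. g z * indicator (B j) z)" for j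
    using B(3)[of j] bdd_meas_g[OF B(1)] by blast
  show "E (lev k) y = trunc k x"
  proof (rule LIMSEQ_unique)
    show "(\<lambda>j. E (lev k) (bdd_int (\<lambda>z. g z * indicator (B j) z) x)) \<longlonglongrightarrow> E (lev k) y"
      by (intro tendsto_intros lim)
    \<comment> \<open>Both sides integrate g cut down to \<open>lev k\<close> and to
      \<open>B j\<close>. The right-hand form has a known limit, as the sets B exhaust the space up
      to a null set.\<close>
    have "E (lev k) (bdd_int (\<lambda>z. g z * indicator (B j) z) x) = E (B j) (trunc k x)" for j
      unfolding trunc_def bdd_int_restrict(2)[OF meas lev_sets, symmetric]
        bdd_int_restrict(2)[OF bdd_meas_lev B(1), symmetric] by (simp add: mult_ac)
    then show "(\<lambda>j. E (lev k) (bdd_int (\<lambda>z. g z * indicator (B j) z) x)) \<longlonglongrightarrow> trunc k x"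
      using E_incseq_LIMSEQ[of B "trunc k x", OF B(1,2)] B(4) by simp
  qed
qed

lemma bdd_int_lev_Diff_null:
  assumes "N \<in> sets M" "E N = 0"
  shows "bdd_int (\<lambda>z. g z * indicator (lev k - N) z) x = trunc k x"
proof -
  have "bdd_int (\<lambda>z. g z * indicator (lev k - N) z) x
      = bdd_int (\<lambda>z. g z * indicator (lev k) z * indicator (space M - N) z) x"
  proof -
    have "lev k - N = lev k \<inter> (space M - N)"
      by (auto simp: lev_def)
    then show ?thesis
      by (simp add: indicator_inter_arith mult.assoc)
  qed
  also have "\<dots> = trunc k (E (space M - N) x)"
    using assms by (simp add: bdd_int_restrict(1)[OF bdd_meas_lev] trunc_def)
  finally show ?thesis
    using assms by (simp add: E_null_Diff E_space)
qed

section \<open>The quadratic polynomial of the S-spectrum\<close>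

context
  fixes r q :: real
begin

text \<open>The parameters r and q stand for Re(s) and the squared norm of s. The bracketing uses
  differences only, so \<open>bdd_int_diff\<close> and \<open>bdd_int_mult\<close> split the
  integral.\<close>

definition quad :: "complex \<Rightarrow> complex" where
  "quad w = w\<^sup>2 - (2 * of_real r * w - of_real q)"

definition quad_trunc :: "nat \<Rightarrow> 'v \<Rightarrow>\<^sub>L 'v" where
  "quad_trunc k = bdd_int (\<lambda>z. quad (g z) * indicator (lev k) z)"

definition quad_lt :: "real \<Rightarrow> 'a set" where
  "quad_lt \<epsilon> = {z \<in> space M. cmod (quad (g z)) < \<epsilon>}"

lemma quad_meas [measurable]: "(\<lambda>z. quad (g z)) \<in> borel_measurable M"
  unfolding quad_def by measurable

lemma quad_lt_sets [measurable]: "quad_lt \<epsilon> \<in> sets M"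
  unfolding quad_lt_def by measurable

lemma bdd_meas_quad: "bdd_meas (\<lambda>z. quad (g z) * indicator (lev k) z)"
  and quad_trunc_eq: "quad_trunc k x = trunc k (trunc k x) - (2 * r) *\<^sub>R trunc k x + q *\<^sub>R E (lev k) x"
proof -
  let ?g = "\<lambda>z. g z * indicator (lev k) z" and ?c = "\<lambda>a z. of_real a * indicator (lev k) z :: complex"
  have m: "bdd_meas ?g" "bdd_meas (?c a)" for a
    by (rule bdd_meas_lev bdd_meas_indicator[OF lev_sets])+
  have eq: "(\<lambda>z. quad (g z) * indicator (lev k) z) = (\<lambda>z. ?g z * ?g z - (?c (2 * r) z * ?g z - ?c q z))"
    by (auto simp: quad_def indicator_def power2_eq_square)
  show "bdd_meas (\<lambda>z. quad (g z) * indicator (lev k) z)"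
    unfolding eq by (intro bdd_meas_diff bdd_meas_mult m)
  have "scal (of_real a) x = a *\<^sub>R x" for a and x :: 'v
    by (simp add: scal_apply)
  then show "quad_trunc k x = trunc k (trunc k x) - (2 * r) *\<^sub>R trunc k x + q *\<^sub>R E (lev k) x"
    unfolding quad_trunc_def eq
    by (simp only: bdd_int_diff bdd_int_mult bdd_meas_diff bdd_meas_mult m bdd_int_indicator lev_sets
        trunc_def[symmetric] blinfun.diff_left blinfun_apply_blinfun_compose E_lev_trunc)
       (simp del: of_real_mult add: E_lev_trunc)
qed

text \<open>Level k of z depends only on level k of y, which is \<open>trunc k x\<close>. The
  unbounded polynomial thus compresses to the bounded one.\<close>

lemma E_lev_quad:
  assumes "graph x y" "graph y z"
  shows "E (lev k) (z - (2 * r) *\<^sub>R y + q *\<^sub>R x) = quad_trunc k x"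
proof -
  have "E (lev k) z = trunc k (trunc k x)"
    using assms trunc_E_lev[of k k y] by (simp add: graph_def)
  then show ?thesis
    using assms(1) by (simp add: quad_trunc_eq graph_def blinfun.add_right blinfun.diff_right blinfun.scaleR_right)
qed

text \<open>Removing \<open>quad_lt \<epsilon>\<close> keeps the quotient bounded by
  \<open>1 / \<epsilon>\<close> at every level; when the removed set is null, this inverts
  \<open>quad_trunc\<close> on the range of \<open>E (lev k)\<close>.\<close>

definition quad_inv :: "real \<Rightarrow> nat \<Rightarrow> 'v \<Rightarrow>\<^sub>L 'v" where
  "quad_inv \<epsilon> k = bdd_int (\<lambda>z. indicator (lev k - quad_lt \<epsilon>) z / quad (g z))"

context
  fixes \<epsilon> :: real
  assumes \<epsilon>: "\<epsilon> > 0" "E (quad_lt \<epsilon>) = 0"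
begin

lemma quad_inv_bound: "z \<in> space M \<Longrightarrow> cmod (indicator (lev k - quad_lt \<epsilon>) z / quad (g z)) \<le> 1 / \<epsilon>"
  using \<epsilon>(1) by (auto simp: indicator_def quad_lt_def norm_divide lev_def not_less intro!: frac_le)

lemma bdd_meas_quad_inv: "bdd_meas (\<lambda>z. indicator (lev k - quad_lt \<epsilon>) z / quad (g z))"
  by (rule bdd_measI[OF _ quad_inv_bound]) (measurable; auto)

lemma quad_inv_norm_le: "norm (quad_inv \<epsilon> k x) \<le> (1 / \<epsilon>) * norm x"
  unfolding quad_inv_def using bdd_meas_quad_inv \<epsilon>
  by (intro bdd_int_norm_le quad_inv_bound) (auto simp: bdd_meas_def)

text \<open>The product of the two integrands is the indicator of
  \<open>lev k - quad_lt \<epsilon>\<close>, a level set up to a null set.\<close>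

lemma quad_inv_quad: "quad_inv \<epsilon> k (quad_trunc k x) = E (lev k) x"
  and quad_quad_inv: "quad_trunc k (quad_inv \<epsilon> k x) = E (lev k) x"
  and E_lev_quad_inv: "E (lev k) (quad_inv \<epsilon> k x) = quad_inv \<epsilon> k x"
proof -
  have eq: "(indicator (lev k - quad_lt \<epsilon>) z / quad (g z)) * (quad (g z) * indicator (lev k) z)
      = indicator (lev k - quad_lt \<epsilon>) z" for z
    using \<epsilon>(1) by (auto simp: indicator_def quad_lt_def lev_def)
  have E: "E (lev k - quad_lt \<epsilon>) = E (lev k)"
    by (intro E_null_Diff) (auto simp: \<epsilon>)
  have "bdd_int (\<lambda>z. (indicator (lev k - quad_lt \<epsilon>) z / quad (g z)) * (quad (g z) * indicator (lev k) z))
      = E (lev k)"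
    unfolding eq by (simp add: bdd_int_indicator_1 E)
  then show "quad_inv \<epsilon> k (quad_trunc k x) = E (lev k) x" "quad_trunc k (quad_inv \<epsilon> k x) = E (lev k) x"
    using bdd_int_mult[OF bdd_meas_quad_inv bdd_meas_quad, of k k]
      bdd_int_mult[OF bdd_meas_quad bdd_meas_quad_inv, of k k]
    by (simp_all add: quad_inv_def quad_trunc_def mult.commute flip: blinfun_apply_blinfun_compose)
  have "(\<lambda>z. (indicator (lev k - quad_lt \<epsilon>) z / quad (g z)) * indicator (lev k) z)
      = (\<lambda>z. indicator (lev k - quad_lt \<epsilon>) z / quad (g z))"
    by (auto simp: indicator_def)
  then show "E (lev k) (quad_inv \<epsilon> k x) = quad_inv \<epsilon> k x"
    using bdd_int_restrict(2)[OF bdd_meas_quad_inv lev_sets, of k k x] by (simp add: quad_inv_def)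
qed

text \<open>\<open>quad_inv\<close> recovers the compression of x from that of the image, with a
  constant independent of the level, so the bound survives the limit.\<close>

lemma quad_lower_bound:
  assumes "graph x y" "graph y z"
  shows "norm x \<le> (1 / \<epsilon>) * norm (z - (2 * r) *\<^sub>R y + q *\<^sub>R x)"
proof (rule Lim_norm_ubound[OF sequentially_bot E_lev_LIMSEQ], rule always_eventually, rule allI)
  fix k
  let ?Q = "z - (2 * r) *\<^sub>R y + q *\<^sub>R x"
  have "norm (E (lev k) x) = norm (quad_inv \<epsilon> k (E (lev k) ?Q))"
    by (simp add: quad_inv_quad E_lev_quad[OF assms])
  also have "\<dots> \<le> (1 / \<epsilon>) * norm (E (lev k) ?Q)"
    by (rule quad_inv_norm_le)
  also have "\<dots> \<le> (1 / \<epsilon>) * norm ?Q"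
    using \<epsilon> by (intro mult_left_mono E_norm_le) auto
  finally show "norm (E (lev k) x) \<le> (1 / \<epsilon>) * norm ?Q" .
qed

text \<open>The preimage is \<open>quad_inv \<epsilon> k v\<close>, which is supported on
  \<open>lev k\<close>. As the vectors \<open>E (lev k) v\<close> tend to v, the range is
  dense.\<close>

lemma quad_range:
  obtains x y z where "graph x y" "graph y z" "z - (2 * r) *\<^sub>R y + q *\<^sub>R x = E (lev k) v"
proof
  let ?x = "quad_inv \<epsilon> k v"
  show "graph ?x (trunc k ?x)" "graph (trunc k ?x) (trunc k (trunc k ?x))"
    using graph_trunc E_lev_quad_inv by blast+
  show "trunc k (trunc k ?x) - (2 * r) *\<^sub>R trunc k ?x + q *\<^sub>R ?x = E (lev k) v"
    using quad_quad_inv[of k v] by (simp add: quad_trunc_eq E_lev_quad_inv)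
qed

end

lemma quad_lt_null:
  assumes C: "\<And>x y z. graph x y \<Longrightarrow> graph y z \<Longrightarrow> norm x \<le> C * norm (z - (2 * r) *\<^sub>R y + q *\<^sub>R x)"
    and "C \<ge> 0" "\<epsilon> > 0" "C * \<epsilon> < 1"
  shows "E (quad_lt \<epsilon>) = 0"
proof (rule blinfun_eqI)
  fix v
  have "E (lev k) (E (quad_lt \<epsilon>) v) = E (lev k) 0" for k
  proof -
    define x where "x = E (lev k) (E (quad_lt \<epsilon>) v)"
    have x1: "E (lev k) x = x"
      by (simp add: x_def E_idem)
    have x2: "E (quad_lt \<epsilon>) x = x"
    proof -
      have "quad_lt \<epsilon> \<inter> (lev k \<inter> quad_lt \<epsilon>) = lev k \<inter> quad_lt \<epsilon>"
        by auto
      moreover have "x = E (lev k \<inter> quad_lt \<epsilon>) v"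
        by (simp add: x_def E_Int)
      ultimately show ?thesis
        by (metis E_Int lev_sets quad_lt_sets sets.Int)
    qed
    have "norm x \<le> C * norm (quad_trunc k x)"
      using C[OF graph_trunc(1) graph_trunc(1), OF x1 graph_trunc(2), OF x1] x1 by (simp add: quad_trunc_eq)
    \<comment> \<open>Since \<open>E (quad_lt \<epsilon>)\<close> fixes x, the integrand may be cut
      down to \<open>quad_lt \<epsilon>\<close>, where it is smaller than
      \<open>\<epsilon>\<close>.\<close>
    also have "quad_trunc k x = bdd_int (\<lambda>z. quad (g z) * indicator (lev k) z * indicator (quad_lt \<epsilon>) z) x"
      by (simp add: bdd_int_restrict(1)[OF bdd_meas_quad] x2 quad_trunc_def)
    also have "C * norm \<dots> \<le> C * (\<epsilon> * norm x)"
      using \<open>\<epsilon> > 0\<close> \<open>C \<ge> 0\<close>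
      by (intro mult_left_mono bdd_int_norm_le) (auto simp: indicator_def quad_lt_def)
    finally have "(1 - C * \<epsilon>) * norm x \<le> 0"
      by (simp add: algebra_simps)
    with \<open>C * \<epsilon> < 1\<close> have "x = 0"
      by (simp add: mult_le_0_iff)
    then show ?thesis
      by (simp add: x_def)
  qed
  then show "E (quad_lt \<epsilon>) v = blinfun_apply 0 v"
    using E_lev_eqI[of "E (quad_lt \<epsilon>) v" 0] by simp
qed

end

end

section \<open>Clifford modules\<close>

lemma cl_mul_add_left: "(x + y) \<odot> a = x \<odot> a + y \<odot> a"
  and cl_mul_scaleR_left: "(r *\<^sub>R x) \<odot> a = r *\<^sub>R (x \<odot> a)"
  and cl_mul_add_right: "x \<odot> (a + b) = x \<odot> a + x \<odot> b"
  and cl_mul_scaleR_right: "x \<odot> (r *\<^sub>R a) = r *\<^sub>R (x \<odot> a)"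
  by (simp_all only: vec_eq_iff cl_mul_nth vector_add_component vector_scaleR_component scaleR_add_right
      scaleR_add_left distrib_left sum.distrib scaleR_sum_right scaleR_scaleR real_scaleR_def mult_ac simp_thms)

lemma cl_mul_sum_left: "(\<Sum>i\<in>I. x i) \<odot> a = (\<Sum>i\<in>I. x i \<odot> a)"
  and cl_mul_sum_right: "y \<odot> (\<Sum>i\<in>I. b i) = (\<Sum>i\<in>I. y \<odot> b i)"
proof -
  have "linear (\<lambda>x. x \<odot> a)" "linear (\<lambda>b. y \<odot> b)"
    by (simp_all add: linear_iff cl_mul_add_left cl_mul_add_right cl_mul_scaleR_left cl_mul_scaleR_right)
  then show "(\<Sum>i\<in>I. x i) \<odot> a = (\<Sum>i\<in>I. x i \<odot> a)" "y \<odot> (\<Sum>i\<in>I. b i) = (\<Sum>i\<in>I. y \<odot> b i)"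
    using linear_sum[of "\<lambda>x. x \<odot> a" x I] linear_sum[of "\<lambda>b. y \<odot> b" b I] by simp_all
qed

lemma one_cl_mul: "cl_one \<odot> a = (a :: 'n::{finite,linorder} cliff)"
proof (rule vec_eq_iff[THEN iffD2], rule allI)
  fix \<gamma> :: "'n set"
  have "(cl_one \<odot> a) $ \<gamma> = (\<Sum>\<alpha>\<in>(UNIV :: 'n set set). if \<alpha> = {} then a $ \<gamma> else 0)"
    unfolding cl_mul_nth
    by (rule sum.cong) (auto simp: cl_basis_def axis_def cl_sign_def)
  then show "(cl_one \<odot> a) $ \<gamma> = a $ \<gamma>"
    by simp
qed

text \<open>Add the double sum to its transpose: the anticommutators of distinct generators vanish,
  and the diagonal contributes -2 times the sum of the squared coefficients.\<close>

lemma imag_sphere_square: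
  fixes \<II> :: "'n::{finite,linorder} cliff"
  assumes "\<II> \<in> imag_sphere"
  shows "\<II> \<odot> \<II> = - cl_one"
proof -
  obtain c where c: "\<II> = (\<Sum>j\<in>UNIV. c j *\<^sub>R cl_gen j)" "(\<Sum>j\<in>UNIV. (c j)\<^sup>2) = 1"
    using assms by (auto simp: imag_sphere_def)
  have eq: "\<II> \<odot> \<II> = (\<Sum>i\<in>UNIV. \<Sum>j\<in>UNIV. (c i * c j) *\<^sub>R (cl_gen j \<odot> cl_gen i))"
    unfolding c(1)
    by (simp only: cl_mul_sum_left cl_mul_sum_right cl_mul_scaleR_left cl_mul_scaleR_right
        scaleR_sum_right scaleR_scaleR)
  also have "\<dots> = (\<Sum>i\<in>UNIV. \<Sum>j\<in>UNIV. (c i * c j) *\<^sub>R (cl_gen i \<odot> cl_gen j))"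
    by (subst sum.swap) (simp only: mult.commute)
  finally have "\<II> \<odot> \<II> + \<II> \<odot> \<II>
      = (\<Sum>i\<in>UNIV. \<Sum>j\<in>UNIV. (c i * c j) *\<^sub>R (cl_gen i \<odot> cl_gen j + cl_gen j \<odot> cl_gen i))"
    using eq by (simp only: scaleR_add_right sum.distrib)
  also have "\<dots> = (\<Sum>i\<in>UNIV. \<Sum>j\<in>UNIV. if j = i then (c i)\<^sup>2 *\<^sub>R (- 2 *\<^sub>R cl_one) else 0)"
  proof (intro sum.cong refl)
    fix i j
    show "(c i * c j) *\<^sub>R (cl_gen i \<odot> cl_gen j + cl_gen j \<odot> cl_gen i)
        = (if j = i then (c i)\<^sup>2 *\<^sub>R (- 2 *\<^sub>R cl_one) else 0)"
      using cl_gen_anticommute[of i j] cl_gen_square[of i]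
      by (auto simp: power2_eq_square scaleR_2 algebra_simps)
  qed
  also have "\<dots> = (\<Sum>i\<in>UNIV. (c i)\<^sup>2) *\<^sub>R (- 2 *\<^sub>R cl_one)"
    unfolding scaleR_sum_left by simp
  finally have "2 *\<^sub>R (\<II> \<odot> \<II>) = 2 *\<^sub>R (- cl_one)"
    by (simp add: c(2) scaleR_2)
  then show ?thesis
    by (simp only: real_vector.scale_cancel_left) simp
qed

text \<open>The product of a conjugated basis element with another has a scalar part only when the
  two agree, and then it is 1. Hence real parts recover the Hilbert space inner product of the
  coefficients.\<close>

lemma cl_Re_inner:
  fixes x y :: "('h::real_inner, 'n::{finite,linorder}) cmod"
  shows "cl_Re (cl_inner x y) = x \<bullet> y"
proof -
  have c: "cl_conj (cl_basis \<beta>) = cl_sign \<beta> \<beta> *\<^sub>R cl_basis \<beta>" for \<beta> :: "'n set"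
    by (auto simp: vec_eq_iff cl_conj_def cl_basis_def axis_def)
  have "(cl_conj (cl_basis \<beta>) \<odot> cl_basis \<alpha>) $ {} = (if \<beta> = \<alpha> then 1 else 0)" for \<alpha> \<beta> :: "'n set"
  proof -
    have "(cl_conj (cl_basis \<beta>) \<odot> cl_basis \<alpha>) $ {}
        = cl_sign \<beta> \<beta> * cl_sign \<beta> \<alpha> * cl_basis (sym_diff \<beta> \<alpha>) $ {}"
      by (simp only: c cl_mul_scaleR_left cl_basis_mul vector_scaleR_component real_scaleR_def mult.assoc)
    moreover have "sym_diff \<beta> \<alpha> = {} \<longleftrightarrow> \<beta> = \<alpha>"
      by auto
    ultimately show ?thesis
      by (auto simp: cl_basis_def axis_def cl_sign_square)
  qed
  then show ?thesis
    by (simp add: cl_Re_def cl_inner_def inner_vec_def if_distrib[of "\<lambda>t. _ * t"] cong: if_cong)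
qed

section \<open>Complex coordinates on the plane and on its one-point compactification\<close>

definition cplane_of_complex :: "'n::finite cliff \<Rightarrow> complex \<Rightarrow> 'n cliff" where
  "cplane_of_complex \<II> w = Re w *\<^sub>R cl_one + Im w *\<^sub>R \<II>"

text \<open>Linear on the whole algebra, hence continuous and compatible with uniform limits without
  restriction to the plane; for \<open>\<II>\<close> on the sphere it is a left inverse of
  \<open>cplane_of_complex\<close>.\<close>

definition complex_of_cplane :: "'n::finite cliff \<Rightarrow> 'n cliff \<Rightarrow> complex" where
  "complex_of_cplane \<II> c = Complex (cl_Re c) (cplane_Im \<II> c)"

lemma bounded_linear_cplane_of_complex: "bounded_linear (cplane_of_complex \<II>)"
  unfolding cplane_of_complex_def
  by (intro bounded_linear_add bounded_linear_compose[OF bounded_linear_scaleR_left] bounded_linear_Re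
      bounded_linear_Im)

lemma bounded_linear_complex_of_cplane: "bounded_linear (complex_of_cplane \<II>)"
proof -
  have eq: "complex_of_cplane \<II> = (\<lambda>c. complex_of_real (c $ {}) + complex_of_real (c \<bullet> \<II>) * \<i>)"
    by (auto simp: complex_of_cplane_def cl_Re_def cplane_Im_def complex_eq_iff)
  show ?thesis
    unfolding eq
    by (intro bounded_linear_add bounded_linear_compose[OF bounded_linear_of_real]
        bounded_linear_compose[OF bounded_linear_mult_left] bounded_linear_vec_nth bounded_linear_inner_left)
qed

lemma cplane_of_complex_mult:
  fixes \<II> :: "'n::{finite,linorder} cliff"
  assumes "\<II> \<in> imag_sphere"
  shows "cplane_of_complex \<II> v \<odot> cplane_of_complex \<II> w = cplane_of_complex \<II> (v * w)"
  unfolding cplane_of_complex_def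
  by (simp add: cl_mul_add_left cl_mul_add_right cl_mul_scaleR_left cl_mul_scaleR_right one_cl_mul
      imag_sphere_square[OF assms] algebra_simps)

lemma complex_of_cplane_of_complex:
  "\<II> \<in> imag_sphere \<Longrightarrow> complex_of_cplane \<II> (cplane_of_complex \<II> w) = w"
  by (simp add: complex_of_cplane_def cplane_of_complex_def cplane_Re_Im)

lemma norm_cplane_of_complex:
  fixes \<II> :: "'n::finite cliff"
  assumes "\<II> \<in> imag_sphere"
  shows "norm (cplane_of_complex \<II> w) = cmod w"
proof -
  have "(cl_one :: 'n cliff) \<bullet> \<II> = 0" "\<II> \<bullet> (cl_one :: 'n cliff) = 0" "(cl_one :: 'n cliff) \<bullet> cl_one = 1"
    using imag_sphere_nth(1)[OF assms] by (simp_all add: cl_basis_def inner_axis' inner_axis)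
  then have "cplane_of_complex \<II> w \<bullet> cplane_of_complex \<II> w = (Re w)\<^sup>2 + (Im w)\<^sup>2"
    using imag_sphere_nth(2)[OF assms]
    by (simp add: cplane_of_complex_def inner_add_left inner_add_right power2_eq_square)
  then show ?thesis
    unfolding cmod_def norm_eq_sqrt_inner[of "cplane_of_complex \<II> w"] by simp
qed

lemma cplane_eq_range: "cplane \<II> = range (cplane_of_complex \<II>)"
proof -
  have "\<exists>w. u *\<^sub>R cl_one + v *\<^sub>R \<II> = cplane_of_complex \<II> w" for u v
    by (rule exI[of _ "Complex u v"]) (simp add: cplane_of_complex_def)
  then show ?thesis
    unfolding cplane_def by (auto simp: cplane_of_complex_def image_iff)
qed

lemma cplane_upper_paravectors:
  assumes "\<II> \<in> imag_sphere"
  shows "cplane_upper \<II> \<subseteq> paravectors"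
proof -
  obtain c where c: "\<II> = (\<Sum>j\<in>UNIV. c j *\<^sub>R cl_gen j)"
    using assms by (auto simp: imag_sphere_def)
  have "\<II> $ \<alpha> = 0" "(cl_one :: 'a cliff) $ \<alpha> = 0" if "card \<alpha> > 1" for \<alpha>
    using that unfolding c by (auto simp: cl_basis_def axis_def intro!: sum.neutral)
  then show ?thesis
    by (auto simp: cplane_upper_def paravectors_def)
qed

lemma openin_Alexandroff_sets_cplane_infty:
  "openin (Alexandroff_compactification (top_of_set (cplane \<II>))) U \<Longrightarrow> U \<in> sets (cplane_infty \<II>)"
  unfolding cplane_infty_def Let_def
  by (subst sets_measure_of)
     (auto intro: sigma_sets.Basic dest!: openin_subset simp del: topspace_Alexandroff_compactification)

lemma space_cplane_infty: "space (cplane_infty \<II>) = insert None (Some ` cplane \<II>)"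
  by (simp add: cplane_infty_def Let_def space_measure_of_conv)

text \<open>Relatively open subsets of the plane stay open in the compactification, so the point at
  infinity is measurable as the complement of the plane. The default 0 at infinity adds that point
  to a preimage exactly when 0 lies in the open set.\<close>

lemma measurable_complex_of_cplane_infty:
  "case_option 0 (complex_of_cplane \<II>) \<in> cplane_infty \<II> \<rightarrow>\<^sub>M borel"
  "{None} \<in> sets (cplane_infty \<II>)"
proof -
  have open_cplane: "Some ` (cplane \<II> \<inter> complex_of_cplane \<II> -` S) \<in> sets (cplane_infty \<II>)" if "open S" for S
    using that bounded_linear_complex_of_cplane[of \<II>]
    by (intro openin_Alexandroff_sets_cplane_infty)
       (auto intro!: continuous_openin_preimage_gen linear_continuous_on)
  have "space (cplane_infty \<II>) - Some ` (cplane \<II> \<inter> complex_of_cplane \<II> -` UNIV) \<in> sets (cplane_infty \<II>)"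
    by (intro sets.compl_sets open_cplane) simp
  also have "space (cplane_infty \<II>) - Some ` (cplane \<II> \<inter> complex_of_cplane \<II> -` UNIV) = {None}"
    by (auto simp: space_cplane_infty)
  finally show None: "{None} \<in> sets (cplane_infty \<II>)" .
  show "case_option 0 (complex_of_cplane \<II>) \<in> cplane_infty \<II> \<rightarrow>\<^sub>M borel"
  proof (rule borel_measurableI)
    fix S :: "complex set" assume "open S"
    have "case_option 0 (complex_of_cplane \<II>) -` S \<inter> space (cplane_infty \<II>)
        = Some ` (cplane \<II> \<inter> complex_of_cplane \<II> -` S) \<union> (if 0 \<in> S then {None} else {})"
      by (auto simp: space_cplane_infty split: option.splits)
    moreover have "(if 0 \<in> S then {None} else {}) \<in> sets (cplane_infty \<II>)"
      using None by simp
    ultimately show "case_option 0 (complex_of_cplane \<II>) -` S \<inter> space (cplane_infty \<II>) \<in> sets (cplane_infty \<II>)"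
      using open_cplane[OF \<open>open S\<close>] by (simp only: sets.Un)
  qed
qed

lemma is_adjoint_inner: "is_adjoint S T \<Longrightarrow> S x \<bullet> y = x \<bullet> T y"
  unfolding is_adjoint_def by (metis cl_Re_inner)

text \<open>Taking real parts turns Clifford adjoints into adjoints for the real inner
  product.\<close>

lemma spectral_calculus_cmod:
  fixes E :: "'a set \<Rightarrow> (('h::{real_inner,banach}, 'n::{finite,linorder}) cmod \<Rightarrow>\<^sub>L ('h, 'n) cmod)"
  assumes E: "spectral_measure M E" and J: "imaginary_op J" and EJ: "associated M E J"
  shows "spectral_calculus M E J"
proof
  fix A :: "'a set" and x y
  assume A: "A \<in> sets M"
  then have P: "orthogonal_projection (E A)"
    using E by (auto simp: spectral_measure_def)
  then show "E A x \<bullet> y = x \<bullet> E A y"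
    by (auto simp: orthogonal_projection_def intro: is_adjoint_inner)
  have "E A o\<^sub>L E A = E A"
    using P by (simp add: orthogonal_projection_def)
  then show "E A (E A x) = E A x"
    by (metis blinfun_apply_blinfun_compose)
  have "J o\<^sub>L E A = E A o\<^sub>L J"
    using EJ A by (simp add: associated_def)
  then show "J (E A x) = E A (J x)"
    by (metis blinfun_apply_blinfun_compose)
next
  fix x y
  show skew: "J x \<bullet> y = - (x \<bullet> J y)" for x y
    using J is_adjoint_inner[of J "- J" x y] by (simp add: imaginary_op_def blinfun.minus_left)
  obtain V where V: "is_adjoint J V" "J o\<^sub>L V = id_blinfun"
    using J by (auto simp: imaginary_op_def unitary_op_def)
  \<comment> \<open>Adjoints are unique, so the inverse supplied by unitarity is \<open>- J\<close>;
    then J V = I says that J squares to minus the identity.\<close>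
  have "V x = - J x"
  proof (rule vector_eq_ldot[THEN iffD1], rule allI)
    fix z
    show "z \<bullet> V x = z \<bullet> - J x"
      using is_adjoint_inner[OF V(1), of z x] skew[of z x] by simp
  qed
  moreover have "J (V x) = x"
    using V(2) by (metis blinfun_apply_blinfun_compose blinfun_apply_id_blinfun)
  ultimately show "J (J x) = - x"
    by (metis blinfun.minus_right minus_equation_iff)
next
  show "E (space M) = id_blinfun"
    using E by (simp add: spectral_measure_def)
  fix D :: "nat \<Rightarrow> 'a set" and x
  show "range D \<subseteq> sets M \<Longrightarrow> disjoint_family D \<Longrightarrow> (\<lambda>i. E (D i) x) sums E (\<Union>i. D i) x"
    using E by (simp add: spectral_measure_def)
qed

section \<open>Agreement of the Clifford-valued integrals with the complex calculus\<close>

locale clifford_calculus = spectral_calculus M E J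
  for M :: "'a measure"
    and E :: "'a set \<Rightarrow> (('h::{real_inner,banach}, 'n::{finite,linorder}) cmod \<Rightarrow>\<^sub>L ('h, 'n) cmod)"
    and J :: "('h, 'n) cmod \<Rightarrow>\<^sub>L ('h, 'n) cmod" +
  fixes \<II> :: "'n cliff"
  assumes \<II>: "\<II> \<in> imag_sphere"
begin

lemma integral_simple_eq:
  assumes h: "\<And>z. z \<in> space M \<Longrightarrow> h z = cplane_of_complex \<II> (g z)"
  shows "integral_simple \<II> M E J h = simple_int g"
proof -
  have inj: "inj_on (cplane_of_complex \<II>) X" for X
    by (rule inj_on_inverseI) (rule complex_of_cplane_of_complex[OF \<II>])
  have Re_Im: "cl_Re (cplane_of_complex \<II> c) = Re c" "cplane_Im \<II> (cplane_of_complex \<II> c) = Im c" for c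
    by (simp_all add: cplane_of_complex_def cplane_Re_Im[OF \<II>])
  have "h ` space M = cplane_of_complex \<II> ` g ` space M"
    using h by (auto simp: image_image)
  moreover have "h -` {cplane_of_complex \<II> c} \<inter> space M = g -` {c} \<inter> space M" for c
    using h inj_eq[OF inj[of UNIV]] by auto
  ultimately show ?thesis
    unfolding integral_simple_def simple_int_def
    by (simp add: sum.reindex[OF inj] Re_Im)
qed

text \<open>The coordinate maps between the plane and the complex numbers are bounded linear, so
  they exchange the simple uniform approximations on both sides. Both descriptions then have the
  same candidates A.\<close>

lemma integral_bounded_eq:
  assumes h: "\<And>z. z \<in> space M \<Longrightarrow> h z = cplane_of_complex \<II> (g z)"
  shows "integral_bounded \<II> M E J h = bdd_int g"
proof -
  have "(\<exists>gs. (\<forall>j. simple_function M (gs j) \<and> gs j ` space M \<subseteq> cplane \<II>) \<and>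
      uniform_limit (space M) gs h sequentially \<and> (\<lambda>j. integral_simple \<II> M E J (gs j)) \<longlonglongrightarrow> A)
    \<longleftrightarrow> has_bdd_int g A" (is "?L \<longleftrightarrow> _") for A
  proof
    assume ?L
    then obtain gs where gs: "\<And>j. simple_function M (gs j)" "\<And>j. gs j ` space M \<subseteq> cplane \<II>"
      "uniform_limit (space M) gs h sequentially" "(\<lambda>j. integral_simple \<II> M E J (gs j)) \<longlonglongrightarrow> A"
      by blast
    let ?p = "complex_of_cplane \<II>"
    have "simple_function M (\<lambda>z. ?p (gs j z))" for j
      by (rule simple_function_compose1[OF gs(1)])
    moreover have "uniform_limit (space M) (\<lambda>j z. ?p (gs j z)) g sequentially"
      using bounded_linear.uniform_limit[OF bounded_linear_complex_of_cplane gs(3)]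
    proof (rule uniform_limit_cong'[THEN iffD1, rotated 2])
      show "?p (h z) = g z" if "z \<in> space M" for z
        by (subst h[OF that]) (rule complex_of_cplane_of_complex[OF \<II>])
    qed simp
    moreover have "integral_simple \<II> M E J (gs j) = simple_int (\<lambda>z. ?p (gs j z))" for j
      using gs(2)[of j]
      by (intro integral_simple_eq) (auto simp: cplane_eq_range complex_of_cplane_of_complex[OF \<II>])
    ultimately show "has_bdd_int g A"
      unfolding has_bdd_int_def using gs(4) by (intro exI[of _ "\<lambda>j z. ?p (gs j z)"]) simp
  next
    assume "has_bdd_int g A"
    then obtain gs where gs: "\<And>j. simple_function M (gs j)"
      "uniform_limit (space M) gs g sequentially" "(\<lambda>j. simple_int (gs j)) \<longlonglongrightarrow> A"
      unfolding has_bdd_int_def by blast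
    let ?p = "cplane_of_complex \<II>"
    have "simple_function M (\<lambda>z. ?p (gs j z))" for j
      by (rule simple_function_compose1[OF gs(1)])
    moreover have "(\<lambda>z. ?p (gs j z)) ` space M \<subseteq> cplane \<II>" for j
      by (auto simp: cplane_eq_range)
    moreover have "uniform_limit (space M) (\<lambda>j z. ?p (gs j z)) h sequentially"
      using bounded_linear.uniform_limit[OF bounded_linear_cplane_of_complex gs(2)]
      by (rule uniform_limit_cong'[THEN iffD1, rotated 2]) (simp_all add: h)
    moreover have "integral_simple \<II> M E J (\<lambda>z. ?p (gs j z)) = simple_int (gs j)" for j
      by (rule integral_simple_eq) simp
    ultimately show ?L
      using gs(3) by (intro exI[of _ "\<lambda>j z. ?p (gs j z)"]) simp
  qed
  then show ?thesis
    by (simp add: integral_bounded_def bdd_int_def)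
qed

lemma scalar_measure_eq: "scalar_measure M E x = weight x"
  unfolding scalar_measure_def weight_def
proof (rule measure_of_eq[OF sets.space_closed])
  fix A assume "A \<in> sigma_sets (space M) (sets M)"
  then have "A \<in> sets M"
    by (simp add: sets.sigma_sets_eq)
  then show "ennreal (cl_Re (cl_inner (E A x) x)) = ennreal ((norm (E A x))\<^sup>2)"
    by (simp add: cl_Re_inner E_norm_sq inner_commute)
qed

end

section \<open>The integral of the extended function and its S-resolvent set\<close>

locale clifford_integral = clifford_calculus M E J \<II>
  for M :: "'a measure"
    and E :: "'a set \<Rightarrow> (('h::{real_inner,banach}, 'n::{finite,linorder}) cmod \<Rightarrow>\<^sub>L ('h, 'n) cmod)"
    and J :: "('h, 'n) cmod \<Rightarrow>\<^sub>L ('h, 'n) cmod"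
    and \<II> :: "'n cliff" +
  fixes f :: "'a \<Rightarrow> 'n cliff option"
  assumes f_meas: "f \<in> M \<rightarrow>\<^sub>M cplane_infty \<II>"
    and f_None: "E {z \<in> space M. f z = None} = 0"
begin

text \<open>The value 0 at the poles places them in every level set; they are removed explicitly
  wherever f itself must be finite.\<close>

definition fin :: "'a \<Rightarrow> complex" where
  "fin z = case_option 0 (complex_of_cplane \<II>) (f z)"

sublocale spectral_function M E J fin
proof
  show "fin \<in> borel_measurable M"
    using measurable_compose[OF f_meas measurable_complex_of_cplane_infty(1)] by (simp add: fin_def[abs_def])
qed

lemma f_Some: "z \<in> space M \<Longrightarrow> f z = Some c \<Longrightarrow> c = cplane_of_complex \<II> (fin z)"
  using measurable_space[OF f_meas, of z]
  by (auto simp: space_cplane_infty fin_def cplane_eq_range complex_of_cplane_of_complex[OF \<II>])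

definition poles :: "'a set" where
  "poles = {z \<in> space M. f z = None}"

lemma poles_sets [measurable]: "poles \<in> sets M"
proof -
  have "f -` {None} \<inter> space M \<in> sets M"
    by (rule measurable_sets[OF f_meas measurable_complex_of_cplane_infty(2)])
  also have "f -` {None} \<inter> space M = poles"
    by (auto simp: poles_def)
  finally show ?thesis .
qed

lemma E_poles: "E poles = 0"
  using f_None by (simp add: poles_def)

abbreviation T :: "('h, 'n) cmod operator" where
  "T \<equiv> spectral_integral \<II> M E J f"

text \<open>The integrand of the definition and the square of \<open>fin\<close> differ at most on
  the poles, which are null for every scalar measure.\<close>

lemma dom_T: "op_dom T = {x. \<exists>y. graph x y}"
proof -
  have "(\<integral>\<^sup>+z. (case f z of None \<Rightarrow> \<infinity> | Some c \<Rightarrow> ennreal ((norm c)\<^sup>2)) \<partial>weight x)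
      = (\<integral>\<^sup>+z. ennreal ((cmod (fin z))\<^sup>2) \<partial>weight x)" for x
  proof (rule nn_integral_cong_AE)
    show "AE z in weight x. (case f z of None \<Rightarrow> \<infinity> | Some c \<Rightarrow> ennreal ((norm c)\<^sup>2)) = ennreal ((cmod (fin z))\<^sup>2)"
    proof (rule AE_I)
      show "emeasure (weight x) poles = 0"
        by (simp add: emeasure_weight E_poles)
      show "{z \<in> space (weight x). \<not> (case f z of None \<Rightarrow> \<infinity> | Some c \<Rightarrow> ennreal ((norm c)\<^sup>2))
          = ennreal ((cmod (fin z))\<^sup>2)} \<subseteq> poles"
        using f_Some norm_cplane_of_complex[OF \<II>] by (fastforce simp: poles_def split: option.splits)
    qed simp
  qed
  then show ?thesis
    by (simp add: spectral_integral_def scalar_measure_eq graph_domain_iff)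
qed

lemma integral_bounded_cutoff:
  assumes "\<forall>z\<in>B. \<exists>c. f z = Some c \<and> norm c \<le> C"
  shows "integral_bounded \<II> M E J (\<lambda>z. if z \<in> B then the (f z) else 0) = bdd_int (\<lambda>z. fin z * indicator B z)"
  using assms f_Some
  by (intro integral_bounded_eq) (auto simp: indicator_def cplane_of_complex_def)

text \<open>The description picks y because every admissible sequence leads to a graph point, which
  is unique, and because \<open>lev k - poles\<close> is an admissible sequence.\<close>

lemma app_T:
  assumes xy: "graph x y"
  shows "op_app T x = y"
proof -
  let ?R = "\<lambda>B :: nat \<Rightarrow> 'a set. \<lambda>y.
      (\<forall>j. B j \<in> sets M \<and> B j \<subseteq> B (Suc j) \<and> (\<exists>C. \<forall>z\<in>B j. \<exists>c. f z = Some c \<and> norm c \<le> C)) \<and>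
      E (\<Union>j. B j) = id_blinfun \<and>
      (\<lambda>j. integral_bounded \<II> M E J (\<lambda>z. if z \<in> B j then the (f z) else 0) x) \<longlonglongrightarrow> y"
  have unique: "y' = y" if "?R B y'" for B y'
  proof -
    have B: "B j \<in> sets M" "B j \<subseteq> B (Suc j)" "\<exists>C. \<forall>z\<in>B j. \<exists>c. f z = Some c \<and> norm c \<le> C" for j
      using that by blast+
    have "graph x y'"
    proof (rule graph_of_LIMSEQ[of B])
      fix j
      obtain C where C: "\<forall>z\<in>B j. \<exists>c. f z = Some c \<and> norm c \<le> C"
        using B(3) by blast
      have "cmod (fin z) \<le> C" if "z \<in> B j" for z
        using C f_Some[of z] norm_cplane_of_complex[OF \<II>] that sets.sets_into_space[OF B(1)[of j]]
        by (metis subsetD)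
      then show "\<exists>C. \<forall>z\<in>B j. cmod (fin z) \<le> C"
        by blast
    next
      have "integral_bounded \<II> M E J (\<lambda>z. if z \<in> B j then the (f z) else 0)
          = bdd_int (\<lambda>z. fin z * indicator (B j) z)" for j
        using B(3)[of j] integral_bounded_cutoff by blast
      then show "(\<lambda>j. bdd_int (\<lambda>z. fin z * indicator (B j) z) x) \<longlonglongrightarrow> y'"
        using that by simp
    qed (use that B in auto)
    then show ?thesis
      using graph_unique xy by blast
  qed
  have exists: "?R (\<lambda>k. lev k - poles) y"
  proof -
    have bd: "\<forall>z\<in>lev k - poles. \<exists>c. f z = Some c \<and> norm c \<le> real k" for k
    proof
      fix z assume z: "z \<in> lev k - poles"
      then obtain c where c: "f z = Some c"
        by (auto simp: lev_def poles_def)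
      with z f_Some[of z c] norm_cplane_of_complex[OF \<II>, of "fin z"]
      show "\<exists>c. f z = Some c \<and> norm c \<le> real k"
        by (auto simp: lev_def)
    qed
    have lim: "(\<lambda>k. integral_bounded \<II> M E J (\<lambda>z. if z \<in> lev k - poles then the (f z) else 0) x) \<longlonglongrightarrow> y"
      using graph_LIMSEQ[OF xy]
      by (simp only: integral_bounded_cutoff[OF bd] bdd_int_lev_Diff_null poles_sets E_poles)
    have total: "E (\<Union>k. lev k - poles) = id_blinfun"
    proof -
      have "(\<Union>k. lev k - poles) = space M - poles"
        using UN_lev by blast
      then show ?thesis
        by (simp add: E_null_Diff E_poles E_space)
    qed
    have incr: "lev k - poles \<in> sets M" "lev k - poles \<subseteq> lev (Suc k) - poles" for k
      using lev_mono[of k "Suc k"] by auto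
    have "\<exists>C. \<forall>z\<in>lev k - poles. \<exists>c. f z = Some c \<and> norm c \<le> C" for k
      by (rule exI, rule bd)
    then show ?thesis
      by (intro conjI allI incr total lim)
  qed
  show ?thesis
    unfolding spectral_integral_def operator.sel
  proof (rule the_equality)
    show "\<exists>B. ?R B y"
      by (rule exI, rule exists)
  qed (erule exE, rule unique)
qed

lemma graph_zero: "graph 0 0"
  by (simp add: graph_def)

lemma graph_minus: "graph x y \<Longrightarrow> graph x' y' \<Longrightarrow> graph (x - x') (y - y')"
  by (simp add: graph_def blinfun.diff_right)

lemma S_resolvent_set_iff:
  assumes s: "s \<in> paravectors"
  shows "s \<in> S_resolvent_set T \<longleftrightarrow> (\<exists>\<epsilon>>0. E (quad_lt (cl_Re s) ((norm s)\<^sup>2) \<epsilon>) = 0)"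
proof -
  let ?r = "cl_Re s" and ?q = "(norm s)\<^sup>2"
  define D where "D = op_dom (Q_op T s)"
  define Q where "Q = op_app (Q_op T s)"
  have Q: "x \<in> D" "Q x = z - (2 * ?r) *\<^sub>R y + ?q *\<^sub>R x" if "graph x y" "graph y z" for x y z
    using that app_T[OF that(1)] app_T[OF that(2)] by (auto simp: D_def Q_def Q_op_def dom_T)
  have D: "\<exists>y z. graph x y \<and> graph y z" if "x \<in> D" for x
  proof -
    have "x \<in> op_dom T" "op_app T x \<in> op_dom T"
      using that by (simp_all add: D_def Q_op_def)
    then obtain y z where "graph x y" "graph (op_app T x) z"
      unfolding dom_T by blast
    then show ?thesis
      using app_T by metis
  qed
  have zero: "0 \<in> D" "Q 0 = 0"
    using Q[OF graph_zero graph_zero] by simp_all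
  have minus: "x - x' \<in> D" "Q (x - x') = Q x - Q x'" if x: "x \<in> D" and x': "x' \<in> D" for x x'
  proof -
    obtain y z y' z' where g: "graph x y" "graph y z" "graph x' y'" "graph y' z'"
      using D[OF x] D[OF x'] by blast
    show "x - x' \<in> D" "Q (x - x') = Q x - Q x'"
      using Q[OF g(1,2)] Q[OF g(3,4)] Q[OF graph_minus[OF g(1,3)] graph_minus[OF g(2,4)]]
      by (simp_all add: scaleR_diff_right)
  qed
  have "s \<in> S_resolvent_set T \<longleftrightarrow> {x \<in> D. Q x = 0} = {0} \<and> closure (Q ` D) = UNIV \<and>
      (\<exists>C. \<forall>y\<in>Q ` D. norm (inv_into D Q y) \<le> C * norm y)"
    using s by (simp add: S_resolvent_set_def Let_def D_def Q_def)
  also have "\<dots> \<longleftrightarrow> (\<exists>\<epsilon>>0. E (quad_lt ?r ?q \<epsilon>) = 0)"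
  proof
    assume "\<exists>\<epsilon>>0. E (quad_lt ?r ?q \<epsilon>) = 0"
    then obtain \<epsilon> where \<epsilon>: "\<epsilon> > 0" "E (quad_lt ?r ?q \<epsilon>) = 0"
      by blast
    have le: "norm x \<le> (1 / \<epsilon>) * norm (Q x)" if x: "x \<in> D" for x
    proof -
      obtain y z where "graph x y" "graph y z"
        using D[OF x] by blast
      then show ?thesis
        using quad_lower_bound[OF \<epsilon>] Q(2) by simp
    qed
    have kernel: "{x \<in> D. Q x = 0} = {0}"
      using zero le by fastforce
    have dense: "closure (Q ` D) = UNIV"
    proof -
      have range: "E (lev k) v \<in> Q ` D" for k v
      proof -
        obtain x y z where "graph x y" "graph y z" "z - (2 * ?r) *\<^sub>R y + ?q *\<^sub>R x = E (lev k) v"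
          by (rule quad_range[OF \<epsilon>])
        then show ?thesis
          using Q by (metis imageI)
      qed
      have "v \<in> closure (Q ` D)" for v
        unfolding closure_sequential
        by (intro exI[of _ "\<lambda>k. E (lev k) v"] conjI allI range E_lev_LIMSEQ)
      then show ?thesis
        by auto
    qed
    have bound: "\<forall>y\<in>Q ` D. norm (inv_into D Q y) \<le> (1 / \<epsilon>) * norm y"
    proof
      fix y assume "y \<in> Q ` D"
      then have "norm (inv_into D Q y) \<le> (1 / \<epsilon>) * norm (Q (inv_into D Q y))"
        by (intro le inv_into_into)
      also have "Q (inv_into D Q y) = y"
        using \<open>y \<in> Q ` D\<close> by (rule f_inv_into_f)
      finally show "norm (inv_into D Q y) \<le> (1 / \<epsilon>) * norm y" .
    qed
    show "{x \<in> D. Q x = 0} = {0} \<and> closure (Q ` D) = UNIV \<and>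
        (\<exists>C. \<forall>y\<in>Q ` D. norm (inv_into D Q y) \<le> C * norm y)"
      by (intro conjI kernel dense exI[of _ "1 / \<epsilon>"] bound)
  next
    assume R: "{x \<in> D. Q x = 0} = {0} \<and> closure (Q ` D) = UNIV \<and>
        (\<exists>C. \<forall>y\<in>Q ` D. norm (inv_into D Q y) \<le> C * norm y)"
    then obtain C where C: "\<forall>y\<in>Q ` D. norm (inv_into D Q y) \<le> C * norm y"
      by (elim conjE exE)
    \<comment> \<open>\<open>inv_into\<close> is a genuine inverse only if Q is injective; the
      trivial kernel gives this, as D and Q respect differences.\<close>
    have inj: "inj_on Q D"
    proof (rule inj_onI)
      fix x x' assume "x \<in> D" "x' \<in> D" "Q x = Q x'"
      then have "x - x' \<in> {x \<in> D. Q x = 0}"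
        using minus[of x x'] by simp
      also have "\<dots> = {0}"
        using R by (rule conjunct1)
      finally show "x = x'"
        by simp
    qed
    \<comment> \<open>The given C may be negative. Taking the maximum with 0 keeps the bound valid,
      and this \<open>\<epsilon>\<close> makes the product of the two constants less than 1.\<close>
    let ?C = "max C 0" and ?\<epsilon> = "1 / (max C 0 + 1)"
    have "E (quad_lt ?r ?q ?\<epsilon>) = 0"
    proof (rule quad_lt_null)
      fix x y z assume g: "graph x y" "graph y z"
      have "norm x \<le> C * norm (Q x)"
        using bspec[OF C imageI, OF Q(1)[OF g]] by (simp only: inv_into_f_f[OF inj Q(1)[OF g]])
      also have "\<dots> \<le> ?C * norm (Q x)"
        by (intro mult_right_mono) auto
      finally show "norm x \<le> ?C * norm (z - (2 * ?r) *\<^sub>R y + ?q *\<^sub>R x)"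
        by (simp only: Q(2)[OF g])
    qed (auto simp: divide_simps)
    then show "\<exists>\<epsilon>>0. E (quad_lt ?r ?q \<epsilon>) = 0"
      by (intro exI[of _ ?\<epsilon>]) auto
  qed
  finally show ?thesis .
qed

text \<open>In complex coordinates the Clifford polynomial becomes \<open>quad\<close> with the same
  norm. The set where f is finite then differs from \<open>quad_lt\<close> only by the null set of
  poles.\<close>

lemma E_quad_lt_eq:
  "E {z \<in> space M. \<exists>c. f z = Some c \<and> norm (c \<odot> c - (2 * r) *\<^sub>R c + q *\<^sub>R cl_one) < \<epsilon>} = E (quad_lt r q \<epsilon>)"
proof -
  have "norm (c \<odot> c - (2 * r) *\<^sub>R c + q *\<^sub>R cl_one) = cmod (quad r q w)"
    if "c = cplane_of_complex \<II> w" for c w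
  proof -
    have "c \<odot> c - (2 * r) *\<^sub>R c + q *\<^sub>R cl_one = cplane_of_complex \<II> (quad r q w)"
      unfolding that cplane_of_complex_mult[OF \<II>] quad_def power2_eq_square
      by (simp add: cplane_of_complex_def algebra_simps)
    then show ?thesis
      by (simp add: norm_cplane_of_complex[OF \<II>])
  qed
  then have norm_eq: "norm (c \<odot> c - (2 * r) *\<^sub>R c + q *\<^sub>R cl_one) = cmod (quad r q (fin z))"
    if "z \<in> space M" "f z = Some c" for z c
    using f_Some that by blast
  have "{z \<in> space M. \<exists>c. f z = Some c \<and> norm (c \<odot> c - (2 * r) *\<^sub>R c + q *\<^sub>R cl_one) < \<epsilon>}
      = {z \<in> space M. \<exists>c. f z = Some c \<and> cmod (quad r q (fin z)) < \<epsilon>}"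
    using norm_eq by (intro Collect_cong conj_cong refl ex_cong1) simp
  also have "\<dots> = quad_lt r q \<epsilon> - poles"
    by (auto simp: quad_lt_def poles_def)
  finally have "{z \<in> space M. \<exists>c. f z = Some c \<and> norm (c \<odot> c - (2 * r) *\<^sub>R c + q *\<^sub>R cl_one) < \<epsilon>}
      = quad_lt r q \<epsilon> - poles" .
  then show ?thesis
    by (simp add: E_null_Diff E_poles)
qed

end

theorem theorem5p3p14:
  fixes \<II> :: "'n::{finite,linorder} cliff"
    and \<Omega>\<^sub>p :: "'n cliff set"
    and E :: "'n cliff set \<Rightarrow> (('h::{real_inner,banach}, 'n) cmod \<Rightarrow>\<^sub>L ('h, 'n) cmod)"
    and J :: "('h, 'n) cmod \<Rightarrow>\<^sub>L ('h, 'n) cmod"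
    and f :: "'n cliff \<Rightarrow> 'n cliff option"
  assumes "\<II> \<in> imag_sphere"
    and "\<Omega>\<^sub>p \<subseteq> cplane_upper \<II>"
    and "spectral_measure (restrict_space borel \<Omega>\<^sub>p) E"
    and "imaginary_op J"
    and "associated (restrict_space borel \<Omega>\<^sub>p) E J"
    and "f \<in> restrict_space borel \<Omega>\<^sub>p \<rightarrow>\<^sub>M cplane_infty \<II>"
    and "E {z \<in> \<Omega>\<^sub>p. f z = None} = 0"
    and "intrinsic_on_half \<II> \<Omega>\<^sub>p f"
  shows "S_spectrum (spectral_integral \<II> (restrict_space borel \<Omega>\<^sub>p) E J f) \<inter> cplane_upper \<II>
    = {s \<in> cplane_upper \<II>. \<forall>\<epsilon>>0.
        E {z \<in> \<Omega>\<^sub>p. \<exists>c. f z = Some c \<and>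
             norm (c \<odot> c - (2 * cl_Re s) *\<^sub>R c + (norm s)\<^sup>2 *\<^sub>R cl_one) < \<epsilon>} \<noteq> 0}"
proof -
  let ?M = "restrict_space borel \<Omega>\<^sub>p"
  have space: "space ?M = \<Omega>\<^sub>p"
    by (simp add: space_restrict_space)
  interpret spectral_calculus ?M E J
    using assms(3-5) by (rule spectral_calculus_cmod)
  interpret clifford_integral ?M E J \<II> f
    by unfold_locales (use assms(1,6,7) in \<open>simp_all add: space\<close>)
  \<comment> \<open>Points of the closed half plane are paravectors, so there the spectrum is the
    complement of the resolvent set, and negating the criterion gives the claim.\<close>
  show ?thesis
    using cplane_upper_paravectors[OF assms(1)] S_resolvent_set_iff
    unfolding S_spectrum_def E_quad_lt_eq[unfolded space] by auto
qed

end
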